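(* There exists a set $E\subset\mathbb{N}$ of infinite dimension such that for any $p>1$ and any $f\in L^p(\mathbb{T})$ the Riemann sums $R_nf(x)$, $n\in E$, converge (as $n\to\infty$, $n\in E$) for almost every $x\in\mathbb{T}$.
   Context: $\mathbb{T}=\mathbb{R}/\mathbb{Z}=[0,1)$ is the torus with Lebesgue measure, and $R_nf(x)=\frac1n\sum_{k=0}^{n-1}f\left(x+\frac kn\right)$. A chain is an increasing sequence of natural numbers $\{n_k\}$ such that $n_k$ divides $n_{k+1}$ for all $k$. For families of natural numbers $S_1,\ldots,S_d$, denote by $[S_1,\ldots,S_d]$ the set of all natural numbers that are the least common multiple of some numbers $n_1\in S_1,\ldots,n_d\in S_d$. A set $S\subset\mathbb{N}$ has dimension $d$ if $d$ is the least integer such that $S\subset[S_1,\ldots,S_d]$ for some chains $S_1,\ldots,S_d$; $S$ has infinite dimension if there is no such finite $d$. *)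

theory Defs
  imports "HOL-Analysis.Analysis"
begin

definition torus :: "real measure" where
  "torus = lebesgue_on {0..<1}"

text \<open>The sum in \<^term>\<open>x + k / n\<close> is taken modulo 1, hence the \<^const>\<open>frac\<close>.\<close>

definition riemann_sum :: "nat \<Rightarrow> (real \<Rightarrow> complex) \<Rightarrow> real \<Rightarrow> complex" where
  "riemann_sum n f x = (\<Sum>k<n. f (frac (x + real k / real n))) / of_nat n"

definition in_Lp :: "real \<Rightarrow> (real \<Rightarrow> complex) \<Rightarrow> bool" where
  "in_Lp p f \<longleftrightarrow> f \<in> borel_measurable torus \<and> integrable torus (\<lambda>x. norm (f x) powr p)"

text \<open>Natural numbers are positive here. A set containing 0 is never covered by
  chains, so dimension is only meaningful for sets of positive numbers.\<close>

definition chain :: "nat set \<Rightarrow> bool" where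
  "chain S \<longleftrightarrow> (\<exists>s :: nat \<Rightarrow> nat. strict_mono s \<and> (\<forall>k. 0 < s k) \<and> (\<forall>k. s k dvd s (Suc k)) \<and> S = range s)"

definition lcm_set :: "nat \<Rightarrow> (nat \<Rightarrow> nat set) \<Rightarrow> nat set" where
  "lcm_set d S = {LCM i\<in>{1..d}. m i | m. \<forall>i\<in>{1..d}. m i \<in> S i}"

definition covered_by_chains :: "nat set \<Rightarrow> nat \<Rightarrow> bool" where
  "covered_by_chains A d \<longleftrightarrow> 1 \<le> d \<and> (\<exists>S. (\<forall>i\<in>{1..d}. chain (S i)) \<and> A \<subseteq> lcm_set d S)"

definition has_dimension :: "nat set \<Rightarrow> nat \<Rightarrow> bool" where
  "has_dimension A d \<longleftrightarrow> covered_by_chains A d \<and> (\<forall>d'. covered_by_chains A d' \<longrightarrow> d \<le> d')"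

definition infinite_dimension :: "nat set \<Rightarrow> bool" where
  "infinite_dimension A \<longleftrightarrow> \<not> (\<exists>d. has_dimension A d)"

definition converges_along :: "nat set \<Rightarrow> (nat \<Rightarrow> complex) \<Rightarrow> bool" where
  "converges_along A u \<longleftrightarrow> (\<exists>L. (u \<longlongrightarrow> L) (inf sequentially (principal A)))"

end

theory Submission
  imports Defs "HOL-Computational_Algebra.Primes"
begin

text \<open>
  $E$ consists of the products of all primes up to $y$ except $a$ and $b$, for arbitrary $y, a, b$.

  Convergence. $R_n$ averages over the translations by multiples of $1/n$, so $R_m R_n = R_{[m,n]}$, and $R_n$
  is the conditional expectation onto $1/n$-periodic functions. By duality a weak type $(p,p)$ bound for
  $\sup_{n \in E} |R_n f|$ follows from $\int H^q \le C_q \int \sum_n g_n$ for $H = \sum_n R_n g_n$ with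
  $g_n \ge 0$, $\sum_n g_n \le 1$ and $q$ the integer conjugate exponent. Expand $H^q$ and sum first over the
  index with the smallest $y$: if $G$ is the gcd of the remaining indices, the factor may be replaced by
  $\sum_n R_G R_n g_n = \sum_n R_{[G,n]} g_n$. As $G$ misses at most $2(q-1)$ of the primes up to $y$, the
  number of distinct $[G,n]$ is at most $2^{2(q-1)}$, and each of them contributes at most $1$.

  Dimension. A chain orders the primes by the first member that they divide. If $d$ chains covered $E$, then for
  all distinct primes $a, x, b$ some chain would place $x$ strictly before both $a$ and $b$. Colour a pair $i < j$ by the
  set of chains placing $i$ weakly before $j$; among many primes there are $i < j < l$ such that $(i,j)$ and
  $(j,l)$ have the same colour, and then no chain places $j$ before both $i$ and $l$.
\<close>

section \<open>Averages of periodic functions\<close>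

definition period :: "real \<Rightarrow> (real \<Rightarrow> real) \<Rightarrow> bool" where
  "period c F \<longleftrightarrow> (\<forall>x. F (x + c) = F x)"

text \<open>Functions live on the whole line and carry period 1 as a hypothesis, so translations
  need no reduction modulo 1. The main theorem applies this to the real and imaginary parts of
  \<open>f (frac y)\<close>.\<close>

definition avg :: "nat \<Rightarrow> (real \<Rightarrow> real) \<Rightarrow> real \<Rightarrow> real" where
  "avg n F x = (\<Sum>k<n. F (x + real k / real n)) / real n"

lemma period_nat_multiple:
  assumes "period c F"
  shows "F (x + real k * c) = F x"
proof (induction k)
  case (Suc k)
  have "F (x + real (Suc k) * c) = F ((x + real k * c) + c)"
    by (simp add: algebra_simps)
  then show ?case using Suc assms by (simp add: period_def)
qed simp

lemma period_int_multiple: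
  assumes "period c F"
  shows "F (x + of_int k * c) = F x"
proof (cases "k \<ge> 0")
  case True
  then show ?thesis using period_nat_multiple[OF assms, of x "nat k"] by simp
next
  case False
  then show ?thesis using period_nat_multiple[OF assms, of "x + of_int k * c" "nat (- k)"] by simp
qed

lemma period_dvd:
  assumes "period (1 / real l) F" "a dvd l" "l > 0"
  shows "period (1 / real a) F"
proof -
  obtain b where b: "l = a * b" using assms(2) by blast
  then have "1 / real a = real b * (1 / real l)" using assms(3) by simp
  then show ?thesis using period_nat_multiple[OF assms(1), of _ b] by (simp add: period_def)
qed

text \<open>Bezout: dividing gcd(a,b) = u a + v b by a b writes 1/lcm(a,b) as the integer
  combination u/b + v/a of the two periods.\<close>

lemma period_lcm:
  assumes "period (1 / real a) F" "period (1 / real b) F" "a > 0" "b > 0"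
  shows "period (1 / real (lcm a b)) F"
proof -
  obtain u v where uv: "u * int a + v * int b = gcd (int a) (int b)"
    using bezout_int by blast
  have "real (lcm a b) * real (gcd a b) = real a * real b"
    by (metis mult.commute of_nat_mult prod_gcd_lcm_nat)
  moreover have "real (gcd a b) = of_int u * real a + of_int v * real b"
    using arg_cong[OF uv, of real_of_int] by (simp add: gcd_int_int_eq)
  moreover have "real (gcd a b) > 0" "real (lcm a b) > 0" using assms by (auto simp: lcm_pos_nat)
  ultimately have eq: "1 / real (lcm a b) = of_int u * (1 / real b) + of_int v * (1 / real a)"
    using assms(3,4) by (simp add: divide_simps) (simp add: algebra_simps)
  show ?thesis unfolding period_def eq
    using period_int_multiple[OF assms(1)] period_int_multiple[OF assms(2)]
    by (metis add.assoc)
qed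

lemma period_avg_same:
  assumes "period c F"
  shows "period c (avg n F)"
proof -
  have "F (x + c + t) = F (x + t)" for x t
    using assms unfolding period_def by (metis add.commute add.left_commute)
  then show ?thesis by (simp add: period_def avg_def)
qed

lemma period_avg:
  assumes "period 1 F" "n > 0"
  shows "period (1 / real n) (avg n F)"
  unfolding period_def
proof
  fix x
  let ?f = "\<lambda>k. F (x + real k / real n)"
  have "(\<Sum>k<n. F (x + 1 / real n + real k / real n)) = (\<Sum>k<n. ?f (Suc k))"
    by (intro sum.cong) (auto simp: add_divide_distrib algebra_simps)
  also have "\<dots> = (\<Sum>k<Suc n. ?f k) - ?f 0" by (subst sum.lessThan_Suc_shift) simp
  also have "\<dots> = (\<Sum>k<n. ?f k)" using assms by (simp add: period_def)
  finally show "avg n F (x + 1 / real n) = avg n F x" by (simp add: avg_def)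
qed

lemma avg_period:
  assumes "period (1 / real n) F" "n > 0"
  shows "avg n F = F"
proof
  fix x
  have "F (x + real k / real n) = F x" for k
    using period_nat_multiple[OF assms(1), of x k] by simp
  then show "avg n F x = F x" using assms(2) by (simp add: avg_def)
qed

lemma avg_commute: "avg a (avg b F) = avg b (avg a F)"
proof
  fix x
  have "(\<Sum>j<a. \<Sum>k<b. F (x + real j / real a + real k / real b)) =
        (\<Sum>k<b. \<Sum>j<a. F (x + real k / real b + real j / real a))"
    by (subst sum.swap) (simp add: algebra_simps)
  then show "avg a (avg b F) x = avg b (avg a F) x"
    by (simp add: avg_def sum_divide_distrib[symmetric] mult.commute)
qed

text \<open>The composition inherits the periods 1/a and 1/b, hence 1/l for the lcm l, and so is
  fixed by \<open>avg l\<close>. Once \<open>avg l\<close> is commuted to the inside, the two outer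
  averages act on a function with period 1/l and do nothing.\<close>

lemma avg_avg:
  assumes F: "period 1 F" and a: "a > 0" and b: "b > 0"
  shows "avg a (avg b F) = avg (lcm a b) F"
proof -
  let ?l = "lcm a b"
  have l: "?l > 0" using a b by (simp add: lcm_pos_nat)
  have "period (1 / real ?l) (avg a (avg b F))"
    using period_lcm[OF period_avg[OF period_avg_same[OF F] a] period_avg_same[OF period_avg[OF F b]] a b] .
  then have "avg a (avg b F) = avg ?l (avg a (avg b F))"
    using avg_period l by metis
  also have "\<dots> = avg a (avg b (avg ?l F))" by (metis avg_commute)
  also have "\<dots> = avg ?l F"
    using avg_period[OF period_dvd[OF period_avg[OF F l] _ l]] a b by simp
  finally show ?thesis .
qed

lemma avg_nonneg: "(\<And>x. F x \<ge> 0) \<Longrightarrow> avg n F x \<ge> 0"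
  by (simp add: avg_def sum_nonneg)

lemma avg_le:
  assumes "\<And>x. F x \<le> c" "n > 0"
  shows "avg n F x \<le> c"
  using sum_bounded_above[of "{..<n}" "\<lambda>k. F (x + real k / real n)" c] assms
  by (simp add: avg_def divide_simps mult.commute)

lemma avg_sum: "avg n (\<lambda>x. \<Sum>i\<in>I. f i x) x = (\<Sum>i\<in>I. avg n (f i) x)"
  unfolding avg_def by (subst sum.swap) (simp add: sum_divide_distrib)

lemma avg_abs_diff_le: "\<bar>avg n F x - avg n G x\<bar> \<le> avg n (\<lambda>x. \<bar>F x - G x\<bar>) x"
proof -
  have "avg n F x - avg n G x = (\<Sum>k<n. F (x + real k / real n) - G (x + real k / real n)) / real n"
    by (simp add: avg_def sum_subtractf diff_divide_distrib)
  then show ?thesis by (simp add: avg_def divide_right_mono sum_abs)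
qed

section \<open>Powers of a sum bounded by sums over ordered tuples\<close>

text \<open>This is the sum of the products of \<open>h\<close> over r-tuples whose
  \<open>\<kappa>\<close> values decrease weakly, starting from at most K. Nesting it from the
  largest value inwards lets an induction extract one factor at a time.\<close>

primrec ordered_sum :: "'i set \<Rightarrow> ('i \<Rightarrow> nat) \<Rightarrow> ('i \<Rightarrow> real) \<Rightarrow> nat \<Rightarrow> nat \<Rightarrow> real" where
  "ordered_sum I \<kappa> h 0 = (\<lambda>K. 1)"
| "ordered_sum I \<kappa> h (Suc r) = (\<lambda>K. \<Sum>i | i \<in> I \<and> \<kappa> i \<le> K. h i * ordered_sum I \<kappa> h r (\<kappa> i))"

text \<open>Factor out a - b; each of the remaining r + 1 products of powers is at most a^r.\<close>

lemma power_Suc_diff_le: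
  fixes a b :: real
  assumes "0 \<le> b" "b \<le> a"
  shows "a ^ Suc r - b ^ Suc r \<le> real (Suc r) * ((a - b) * a ^ r)"
proof -
  have "(\<Sum>p<Suc r. a ^ p * b ^ (r - p)) \<le> (\<Sum>p<Suc r. a ^ r)"
  proof (intro sum_mono)
    fix p assume "p \<in> {..<Suc r}"
    then have "a ^ r = a ^ p * a ^ (r - p)" by (simp flip: power_add)
    then show "a ^ p * b ^ (r - p) \<le> a ^ r"
      using assms by (simp add: mult_left_mono power_mono)
  qed
  then have "(a - b) * (\<Sum>p<Suc r. a ^ p * b ^ (r - p)) \<le> (a - b) * (\<Sum>p<Suc r. a ^ r)"
    using assms by (intro mult_left_mono) auto
  then show ?thesis
    unfolding diff_power_eq_sum by (simp add: algebra_simps)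
qed

text \<open>Only the position of the factor with largest \<open>\<kappa>\<close> is chosen at each step; ties are counted repeatedly,
  which is harmless for an upper bound.\<close>

lemma power_sum_le_ordered_sum:
  assumes I: "finite I" and h: "\<And>i. h i \<ge> 0"
  shows "(\<Sum>i | i \<in> I \<and> \<kappa> i \<le> K. h i) ^ r \<le> fact r * ordered_sum I \<kappa> h r K"
proof (induction r arbitrary: K)
  case (Suc r)
  define H where "H K = (\<Sum>i | i \<in> I \<and> \<kappa> i \<le> K. h i)" for K
  define J where "J K = {i. i \<in> I \<and> \<kappa> i = K}" for K
  have fin: "finite (J K)" "finite {i. i \<in> I \<and> \<kappa> i \<le> K}" for K
    using I by (auto simp: J_def)
  have split: "{i. i \<in> I \<and> \<kappa> i \<le> Suc K} = {i. i \<in> I \<and> \<kappa> i \<le> K} \<union> J (Suc K)" for K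
    by (auto simp: J_def)
  have disj: "{i. i \<in> I \<and> \<kappa> i \<le> K} \<inter> J (Suc K) = {}" for K
    by (auto simp: J_def)
  have H_Suc: "H (Suc K) = H K + sum h (J (Suc K))" for K
    unfolding H_def split by (rule sum.union_disjoint) (use fin disj in auto)
  have H_nonneg: "H K \<ge> 0" for K
    unfolding H_def by (simp add: sum_nonneg h)
  \<comment> \<open>A discrete form of integrating (r+1) H^r dH. Raising the cutoff by one adds the
    level \<open>J (Suc K)\<close>, on which \<open>H (\<kappa> i)\<close> is the new value
    \<open>H (Suc K)\<close>, and \<open>power_Suc_diff_le\<close> bounds the increment.\<close>
  have "H K ^ Suc r \<le> real (Suc r) * (\<Sum>i | i \<in> I \<and> \<kappa> i \<le> K. h i * H (\<kappa> i) ^ r)"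
  proof (induction K)
    case 0
    have "(\<Sum>i | i \<in> I \<and> \<kappa> i \<le> 0. h i * H (\<kappa> i) ^ r) = H 0 * H 0 ^ r"
      unfolding H_def[of 0] sum_distrib_right by (intro sum.cong) (auto simp: H_def)
    moreover have "H 0 * H 0 ^ r \<ge> 0" using H_nonneg by simp
    ultimately show ?case
      by (simp add: algebra_simps H_nonneg)
  next
    case (Suc K)
    have "H (Suc K) ^ Suc r - H K ^ Suc r \<le> real (Suc r) * ((H (Suc K) - H K) * H (Suc K) ^ r)"
      by (rule power_Suc_diff_le) (use H_nonneg H_Suc h in \<open>auto simp: sum_nonneg\<close>)
    also have "(H (Suc K) - H K) * H (Suc K) ^ r = (\<Sum>i\<in>J (Suc K). h i * H (\<kappa> i) ^ r)"
      by (simp add: H_Suc[of K] sum_distrib_right J_def)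
    finally show ?case
      using Suc unfolding split
      by (subst sum.union_disjoint) (use fin disj in \<open>auto simp: algebra_simps\<close>)
  qed
  also have "\<dots> \<le> real (Suc r) * (\<Sum>i | i \<in> I \<and> \<kappa> i \<le> K. h i * (fact r * ordered_sum I \<kappa> h r (\<kappa> i)))"
    using Suc h by (intro mult_left_mono sum_mono) (auto simp: H_def)
  also have "\<dots> = fact (Suc r) * ordered_sum I \<kappa> h (Suc r) K"
    by (simp add: sum_distrib_left mult_ac)
  finally show ?case by (simp add: H_def)
qed simp

section \<open>Integration over the torus\<close>

definition torus_integrable :: "(real \<Rightarrow> real) \<Rightarrow> bool" where
  "torus_integrable F \<longleftrightarrow> period 1 F \<and> integrable torus F"

text \<open>The class of admissible multipliers: it is closed under sums, products, powers and
  averages, and multiplication by a member preserves \<open>torus_integrable\<close>.\<close>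

definition torus_bounded :: "(real \<Rightarrow> real) \<Rightarrow> bool" where
  "torus_bounded F \<longleftrightarrow> torus_integrable F \<and> (\<exists>B. \<forall>x. \<bar>F x\<bar> \<le> B)"

lemma finite_measure_torus: "finite_measure torus"
  by (rule finite_measureI) (simp add: torus_def emeasure_restrict_space)

lemma space_torus [simp]: "space torus = {0..<1}"
  by (simp add: torus_def)

lemma integrable_torus_iff:
  "integrable torus F \<longleftrightarrow> integrable lebesgue (\<lambda>x. indicator {0..<1} x * F x)" for F :: "real \<Rightarrow> real"
  by (simp add: torus_def integrable_restrict_space)

lemma integral_torus:
  "integral\<^sup>L torus F = integral\<^sup>L lebesgue (\<lambda>x. indicator {0..<1} x * F x)" for F :: "real \<Rightarrow> real"
  by (simp add: torus_def integral_restrict_space)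

lemma lebesgue_shift:
  fixes F :: "real \<Rightarrow> real"
  assumes "integrable lebesgue F"
  shows "integrable lebesgue (\<lambda>x. F (x + c))" "(\<integral>x. F (x + c) \<partial>lebesgue) = (\<integral>x. F x \<partial>lebesgue)"
  using lebesgue_integrable_real_affine_iff[of 1 F c] lebesgue_integral_real_affine[of 1 F c] assms
  by (simp_all add: add.commute)

text \<open>Cut [0,1) at c. The shifted function reads the piece [c,1) through a translation by c
  and, by periodicity, the piece [0,c) through a translation by c - 1; both preserve Lebesgue
  measure.\<close>

lemma torus_integrable_shift_unit:
  assumes F: "torus_integrable F" and c: "0 \<le> c" "c \<le> 1"
  shows "integrable torus (\<lambda>x. F (x + c))" "(\<integral>x. F (x + c) \<partial>torus) = (\<integral>x. F x \<partial>torus)"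
proof -
  let ?X = "\<lambda>x. indicator {c..<1} x * F x" and ?Y = "\<lambda>x. indicator {0..<c} x * F x"
  have per: "F (x + c - 1) = F (x + c)" for x
    using F unfolding torus_integrable_def period_def by (metis diff_add_cancel)
  have int: "integrable lebesgue (\<lambda>x. indicator {0..<1} x * F x)"
    using F by (simp add: torus_integrable_def integrable_torus_iff)
  have "integrable lebesgue (\<lambda>x. indicator {c..<1} x *\<^sub>R (indicator {0..<1} x * F x))"
    by (rule integrable_mult_indicator[OF _ int]) simp
  then have X: "integrable lebesgue ?X"
    by (rule back_subst[of "integrable lebesgue"]) (use c in \<open>auto simp: indicator_def\<close>)
  have "integrable lebesgue (\<lambda>x. indicator {0..<c} x *\<^sub>R (indicator {0..<1} x * F x))"
    by (rule integrable_mult_indicator[OF _ int]) simp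
  then have Y: "integrable lebesgue ?Y"
    by (rule back_subst[of "integrable lebesgue"]) (use c in \<open>auto simp: indicator_def\<close>)
  have split: "(\<lambda>x. indicator {0..<1} x * F (x + c)) = (\<lambda>x. ?X (x + c) + ?Y (x + (c - 1)))"
    using c per by (auto simp: indicator_def fun_eq_iff algebra_simps)
  have join: "(\<lambda>x. indicator {0..<1} x * F x) = (\<lambda>x. ?X x + ?Y x)"
    by (rule ext) (use c in \<open>auto simp: indicator_def\<close>)
  show "integrable torus (\<lambda>x. F (x + c))"
    unfolding integrable_torus_iff split by (intro Bochner_Integration.integrable_add lebesgue_shift X Y)
  have "(\<integral>x. ?X (x + c) + ?Y (x + (c - 1)) \<partial>lebesgue) = (\<integral>x. ?X x \<partial>lebesgue) + (\<integral>x. ?Y x \<partial>lebesgue)"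
    using lebesgue_shift[OF X, of c] lebesgue_shift[OF Y, of "c - 1"]
    by (subst Bochner_Integration.integral_add) auto
  also have "\<dots> = (\<integral>x. ?X x + ?Y x \<partial>lebesgue)"
    by (rule Bochner_Integration.integral_add[symmetric, OF X Y])
  finally show "(\<integral>x. F (x + c) \<partial>torus) = (\<integral>x. F x \<partial>torus)"
    unfolding integral_torus split join .
qed

lemma torus_integrable_shift:
  assumes F: "torus_integrable F"
  shows "torus_integrable (\<lambda>x. F (x + c))" "(\<integral>x. F (x + c) \<partial>torus) = (\<integral>x. F x \<partial>torus)"
proof -
  have "F (x + c) = F (x + frac c)" for x
    using period_int_multiple[of 1 F "x + frac c" "\<lfloor>c\<rfloor>"] F by (simp add: torus_integrable_def frac_def)
  moreover have "period 1 (\<lambda>x. F (x + frac c))"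
    using F unfolding torus_integrable_def period_def by (metis add.assoc add.commute)
  ultimately show "torus_integrable (\<lambda>x. F (x + c))" "(\<integral>x. F (x + c) \<partial>torus) = (\<integral>x. F x \<partial>torus)"
    using torus_integrable_shift_unit[OF F, of "frac c"] frac_lt_1[of c] by (auto simp: torus_integrable_def)
qed

lemma torus_integrable_sum:
  assumes "\<And>i. i \<in> I \<Longrightarrow> torus_integrable (f i)"
  shows "torus_integrable (\<lambda>x. \<Sum>i\<in>I. f i x)"
  using assms by (auto simp: torus_integrable_def period_def)

lemma torus_integrable_const: "torus_integrable (\<lambda>x. c)"
  using finite_measure.integrable_const[OF finite_measure_torus] by (simp add: torus_integrable_def period_def)

lemma torus_bounded_const: "torus_bounded (\<lambda>x. c)"
  by (auto simp: torus_bounded_def torus_integrable_const)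

lemma torus_boundedI:
  assumes "period 1 F" "F \<in> borel_measurable torus" "\<And>x. \<bar>F x\<bar> \<le> B"
  shows "torus_bounded F"
proof -
  have "integrable torus F"
    using assms by (intro finite_measure.integrable_const_bound[OF finite_measure_torus, of _ B]) auto
  then show ?thesis using assms unfolding torus_bounded_def torus_integrable_def by blast
qed

lemma torus_integrable_mult:
  assumes u: "torus_bounded u" and F: "torus_integrable F"
  shows "torus_integrable (\<lambda>x. u x * F x)"
proof -
  obtain B where B: "\<And>x. \<bar>u x\<bar> \<le> B" using u by (auto simp: torus_bounded_def)
  have "integrable torus (\<lambda>x. u x * F x)"
  proof (rule Bochner_Integration.integrable_bound)
    show "integrable torus (\<lambda>x. B * F x)" using F by (simp add: torus_integrable_def)
    show "(\<lambda>x. u x * F x) \<in> borel_measurable torus"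
      using u F by (auto simp: torus_integrable_def torus_bounded_def intro!: borel_measurable_times)
    have "\<bar>u x\<bar> \<le> \<bar>B\<bar>" for x using B[of x] by linarith
    then show "AE x in torus. norm (u x * F x) \<le> norm (B * F x)"
      by (intro AE_I2) (simp add: abs_mult mult_right_mono)
  qed
  then show ?thesis using u F by (auto simp: torus_bounded_def torus_integrable_def period_def)
qed

lemma torus_bounded_mult:
  assumes u: "torus_bounded u" and v: "torus_bounded v"
  shows "torus_bounded (\<lambda>x. u x * v x)"
proof -
  obtain B C where "\<And>x. \<bar>u x\<bar> \<le> B" "\<And>x. \<bar>v x\<bar> \<le> C" using u v by (auto simp: torus_bounded_def)
  then have "\<bar>u x * v x\<bar> \<le> B * C" for x
    unfolding abs_mult by (meson abs_ge_zero mult_mono order_trans)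
  then show ?thesis using torus_integrable_mult[OF u] v by (auto simp: torus_bounded_def)
qed

lemma torus_bounded_sum:
  assumes "\<And>i. i \<in> I \<Longrightarrow> torus_bounded (f i)"
  shows "torus_bounded (\<lambda>x. \<Sum>i\<in>I. f i x)"
proof -
  have "\<exists>B. \<forall>i\<in>I. \<forall>x. \<bar>f i x\<bar> \<le> B i" using assms unfolding torus_bounded_def by metis
  then obtain B where "\<And>i x. i \<in> I \<Longrightarrow> \<bar>f i x\<bar> \<le> B i" by blast
  then have "\<bar>\<Sum>i\<in>I. f i x\<bar> \<le> (\<Sum>i\<in>I. B i)" for x
    by (intro order_trans[OF sum_abs] sum_mono)
  then show ?thesis using torus_integrable_sum[of I f] assms by (auto simp: torus_bounded_def)
qed

lemma torus_bounded_power: "torus_bounded u \<Longrightarrow> torus_bounded (\<lambda>x. u x ^ r)"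
  by (induction r) (auto intro: torus_bounded_const torus_bounded_mult)

lemma torus_integrable_cmult: "torus_integrable F \<Longrightarrow> torus_integrable (\<lambda>x. c * F x)"
  using torus_integrable_mult[OF torus_bounded_const] .

lemma torus_integrable_avg:
  assumes F: "torus_integrable F"
  shows "torus_integrable (avg n F)" and "n > 0 \<Longrightarrow> (\<integral>x. avg n F x \<partial>torus) = (\<integral>x. F x \<partial>torus)"
proof -
  have eq: "avg n F = (\<lambda>x. \<Sum>k<n. 1 / real n * F (x + real k / real n))"
    by (simp add: avg_def fun_eq_iff sum_divide_distrib)
  show "torus_integrable (avg n F)" unfolding eq by (intro torus_integrable_sum torus_integrable_cmult torus_integrable_shift(1)[OF F])
  assume "n > 0"
  then show "(\<integral>x. avg n F x \<partial>torus) = (\<integral>x. F x \<partial>torus)"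
    unfolding eq using torus_integrable_shift[OF F] by (subst Bochner_Integration.integral_sum) (auto simp: torus_integrable_def)
qed

lemma torus_bounded_avg:
  assumes "torus_bounded F"
  shows "torus_bounded (avg n F)"
proof (cases "n = 0")
  case True
  then show ?thesis by (simp add: avg_def[abs_def] torus_bounded_const)
next
  case False
  obtain B where B: "\<And>x. \<bar>F x\<bar> \<le> B" using assms by (auto simp: torus_bounded_def)
  have "\<bar>avg n F x\<bar> \<le> B" for x
    using avg_abs_diff_le[of n F x "\<lambda>x. 0"] avg_le[of "\<lambda>x. \<bar>F x\<bar>" B n x] B False
    by (simp add: avg_def)
  then show ?thesis using torus_integrable_avg(1) assms by (auto simp: torus_bounded_def)
qed

text \<open>The conditional expectation property: \<open>u\<close> is constant along translations by
  1/n, so it can be pulled out of the average, and averaging preserves integrals.\<close>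

lemma integral_period_avg:
  assumes u: "torus_bounded u" "period (1 / real n) u" and F: "torus_integrable F" and n: "n > 0"
  shows "(\<integral>x. u x * F x \<partial>torus) = (\<integral>x. u x * avg n F x \<partial>torus)"
proof -
  have "u (x + real k / real n) = u x" for x k
    using period_nat_multiple[OF u(2), of x k] by simp
  then have "avg n (\<lambda>x. u x * F x) = (\<lambda>x. u x * avg n F x)"
    by (simp add: avg_def fun_eq_iff sum_distrib_left)
  then show ?thesis using torus_integrable_avg(2)[OF torus_integrable_mult[OF u(1) F] n] by simp
qed

text \<open>Both sides equal the integral of \<open>avg n g * avg n F\<close>, since each average is
  invariant under translations by 1/n.\<close>

lemma integral_avg_adjoint:
  assumes g: "torus_bounded g" and F: "torus_integrable F" and n: "n > 0"
  shows "(\<integral>x. g x * avg n F x \<partial>torus) = (\<integral>x. avg n g x * F x \<partial>torus)"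
proof -
  have "(\<integral>x. avg n g x * F x \<partial>torus) = (\<integral>x. avg n g x * avg n F x \<partial>torus)"
    using g n by (intro integral_period_avg torus_bounded_avg period_avg F) (auto simp: torus_bounded_def torus_integrable_def)
  moreover have "avg n (\<lambda>x. g x * avg n F x) = (\<lambda>x. avg n g x * avg n F x)"
  proof
    fix x
    have "avg n F (x + real k / real n) = avg n F x" for x k
      using period_nat_multiple[OF period_avg[of F n], of x k] F n by (simp add: torus_integrable_def)
    then show "avg n (\<lambda>x. g x * avg n F x) x = avg n g x * avg n F x"
      by (simp add: avg_def[of n "\<lambda>x. g x * avg n F x"] avg_def[of n g] sum_distrib_right)
  qed
  moreover have "(\<integral>x. avg n (\<lambda>x. g x * avg n F x) x \<partial>torus) = (\<integral>x. g x * avg n F x \<partial>torus)"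
    by (intro torus_integrable_avg(2) torus_integrable_mult g torus_integrable_avg(1) F n)
  ultimately show ?thesis by simp
qed

section \<open>Moments of sums of averages\<close>

text \<open>An index pairs a cutoff with a set of omitted numbers. The moment estimate orders
  indices by the cutoff and sees the omitted set only through a bound on its size.\<close>

definition primorial_except :: "nat \<times> nat set \<Rightarrow> nat" where
  "primorial_except i = \<Prod>{p. prime p \<and> p \<le> fst i \<and> p \<notin> snd i}"

lemma finite_primes_le [simp]: "finite {p. prime p \<and> p \<le> (y::nat) \<and> P p}"
  by (rule finite_subset[of _ "{..y}"]) auto

lemma primorial_except_pos: "primorial_except i > 0"
  unfolding primorial_except_def by (intro prod_pos) (auto simp: prime_gt_0_nat)

lemma prime_dvd_primorial_except_iff:
  assumes "prime q"
  shows "q dvd primorial_except (y, e) \<longleftrightarrow> q \<le> y \<and> q \<notin> e"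
proof
  assume "q dvd primorial_except (y, e)"
  then obtain p where "prime p" "p \<le> y" "p \<notin> e" "q dvd p"
    using prime_dvd_prod_iff[of _ q "\<lambda>p. p"] assms by (auto simp: primorial_except_def)
  then show "q \<le> y \<and> q \<notin> e" using primes_dvd_imp_eq[OF assms] by blast
next
  assume "q \<le> y \<and> q \<notin> e"
  then show "q dvd primorial_except (y, e)"
    using assms by (auto simp: primorial_except_def intro: dvd_prod_eqI)
qed

lemma prod_primes_dvd:
  assumes "finite A" "\<And>p. p \<in> A \<Longrightarrow> prime p" "\<And>p. p \<in> A \<Longrightarrow> p dvd n"
  shows "\<Prod>A dvd (n :: nat)"
  using assms
proof (induction A rule: finite_induct)
  case (insert p A)
  have "coprime p (\<Prod>A)"
    using insert by (intro prod_coprime_right) (metis insertCI primes_coprime)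
  then show ?case using insert by (simp add: divides_mult)
qed simp

text \<open>Every prime factor outside D already divides G, so the lcm is determined by which primes
  of D occur in the index.\<close>

lemma card_lcm_primorial_except:
  assumes D: "finite D" and G: "\<And>p. prime p \<Longrightarrow> p \<le> K \<Longrightarrow> p \<notin> D \<Longrightarrow> p dvd G"
    and J: "\<And>i. i \<in> J \<Longrightarrow> fst i \<le> K"
  shows "card ((\<lambda>i. lcm G (primorial_except i)) ` J) \<le> 2 ^ card D"
proof -
  have "lcm G (primorial_except i) \<in> (\<lambda>B. lcm G (\<Prod>B)) ` Pow D" if i: "i \<in> J" for i
  proof -
    let ?P = "{p. prime p \<and> p \<le> fst i \<and> p \<notin> snd i}"
    have "\<Prod>(?P - D) dvd G"
      using J[OF i] G by (intro prod_primes_dvd) auto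
    then have 1: "\<Prod>(?P - D) dvd lcm G (\<Prod>(?P \<inter> D))" by (rule dvd_lcmI1)
    have "coprime (\<Prod>(?P - D)) (\<Prod>(?P \<inter> D))"
      by (intro prod_coprime_left prod_coprime_right primes_coprime) auto
    then have "\<Prod>(?P - D) * \<Prod>(?P \<inter> D) dvd lcm G (\<Prod>(?P \<inter> D))"
      using 1 by (simp add: divides_mult)
    moreover have eq: "\<Prod>?P = \<Prod>(?P - D) * \<Prod>(?P \<inter> D)"
      by (subst prod.union_disjoint[symmetric]) (auto intro: prod.cong)
    ultimately have "lcm G (primorial_except i) dvd lcm G (\<Prod>(?P \<inter> D))" by (simp add: primorial_except_def)
    moreover have "lcm G (\<Prod>(?P \<inter> D)) dvd lcm G (primorial_except i)"
      unfolding primorial_except_def eq by (auto intro: dvd_lcmI2 lcm_least)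
    ultimately have "lcm G (primorial_except i) = lcm G (\<Prod>(?P \<inter> D))" by (rule dvd_antisym)
    then show ?thesis by blast
  qed
  then have sub: "(\<lambda>i. lcm G (primorial_except i)) ` J \<subseteq> (\<lambda>B. lcm G (\<Prod>B)) ` Pow D" by blast
  have fin: "finite ((\<lambda>B. lcm G (\<Prod>B)) ` Pow D)" using D by simp
  have "card ((\<lambda>i. lcm G (primorial_except i)) ` J) \<le> card ((\<lambda>B. lcm G (\<Prod>B)) ` Pow D)"
    by (rule card_mono[OF fin sub])
  also have "\<dots> \<le> 2 ^ card D"
    using card_image_le[of "Pow D" "\<lambda>B. lcm G (\<Prod>B)"] D by (simp add: card_Pow)
  finally show ?thesis .
qed

text \<open>Here r factors remain and s bounds the number of primes possibly missing from the gcd of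
  those extracted. Each extraction costs 2^s and adds at most c missing primes, which gives 2 to the
  power r s + c r (r - 1) / 2.\<close>

primrec moment_const :: "nat \<Rightarrow> nat \<Rightarrow> nat \<Rightarrow> real" where
  "moment_const c 0 s = 1"
| "moment_const c (Suc r) s = 2 ^ s * moment_const c r (s + c)"

lemma moment_const_pos: "moment_const c r s > 0"
  by (induction r arbitrary: s) auto

lemma torus_bounded_ordered_sum:
  assumes "\<And>i. i \<in> I \<Longrightarrow> torus_bounded (h i)"
  shows "torus_bounded (\<lambda>x. ordered_sum I \<kappa> (\<lambda>i. h i x) r K)"
proof (induction r arbitrary: K)
  case (Suc r)
  then show ?case unfolding ordered_sum.simps by (intro torus_bounded_sum torus_bounded_mult) (auto intro: assms)
qed (simp add: torus_bounded_const)

text \<open>Group the indices by the value of \<open>m\<close>: a group shares one averaging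
  operator, applied to a partial sum of the \<open>g i\<close>, which is at most 1.\<close>

lemma sum_avg_le_card:
  assumes J: "finite J" and m: "\<And>i. i \<in> J \<Longrightarrow> m i > 0"
    and g: "\<And>i x. g i x \<ge> 0" "\<And>x. (\<Sum>i\<in>J. g i x) \<le> 1"
  shows "(\<Sum>i\<in>J. avg (m i) (g i) x) \<le> real (card (m ` J))"
proof -
  have "(\<Sum>i\<in>J. avg (m i) (g i) x) = (\<Sum>n\<in>m ` J. \<Sum>i | i \<in> J \<and> m i = n. avg (m i) (g i) x)"
    by (rule sum.image_gen[OF J])
  also have "\<dots> = (\<Sum>n\<in>m ` J. avg n (\<lambda>x. \<Sum>i | i \<in> J \<and> m i = n. g i x) x)"
    unfolding avg_sum by (intro sum.cong) auto
  also have "\<dots> \<le> (\<Sum>n\<in>m ` J. 1)"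
  proof (intro sum_mono avg_le)
    fix n x
    have "(\<Sum>i | i \<in> J \<and> m i = n. g i x) \<le> (\<Sum>i\<in>J. g i x)"
      using J g by (intro sum_mono2) auto
    then show "(\<Sum>i | i \<in> J \<and> m i = n. g i x) \<le> 1" using g(2)[of x] by linarith
  qed (use m in auto)
  finally show ?thesis by simp
qed

text \<open>The function $u$ collects the factors already extracted from the product, whose indices have gcd $G$.\<close>

lemma integral_ordered_sum_le:
  fixes I :: "(nat \<times> nat set) set" and g :: "nat \<times> nat set \<Rightarrow> real \<Rightarrow> real"
  assumes I: "finite I" "\<And>i. i \<in> I \<Longrightarrow> finite (snd i) \<and> card (snd i) \<le> c"
    and g: "\<And>i. i \<in> I \<Longrightarrow> torus_bounded (g i)" "\<And>i x. g i x \<ge> 0" "\<And>x. (\<Sum>i\<in>I. g i x) \<le> 1"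
    and u: "torus_bounded u" "\<And>x. u x \<ge> 0" "period (1 / real G) u" "G > 0"
    and D: "finite D" "card D \<le> s" "\<And>p. prime p \<Longrightarrow> p \<le> K \<Longrightarrow> p \<notin> D \<Longrightarrow> p dvd G"
  shows "(\<integral>x. u x * ordered_sum I fst (\<lambda>i. avg (primorial_except i) (g i) x) r K \<partial>torus)
           \<le> moment_const c r s * (\<integral>x. u x \<partial>torus)"
  using u D
proof (induction r arbitrary: u G D K s)
  case 0
  then show ?case by simp
next
  case (Suc r)
  note u = Suc.prems(1-4) and D = Suc.prems(5-7)
  define h where "h = (\<lambda>i. avg (primorial_except i) (g i))"
  define O' where "O' = (\<lambda>K x. ordered_sum I fst (\<lambda>i. h i x) r K)"
  define J where "J = {i \<in> I. fst i \<le> K}"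
  have J: "finite J" "J \<subseteq> I" using I by (auto simp: J_def)
  have g_bp: "torus_bounded (g i)" if "i \<in> J" for i
    using g(1)[of i] that J by blast
  have h_bp: "torus_bounded (h i)" if "i \<in> I" for i
    unfolding h_def by (intro torus_bounded_avg g that)
  have h_nonneg: "h i x \<ge> 0" for i x
    unfolding h_def by (intro avg_nonneg g)
  have O_bp: "torus_bounded (O' K)" for K
    unfolding O'_def by (intro torus_bounded_ordered_sum h_bp)
  have uh_bp: "torus_bounded (\<lambda>x. u x * h i x)" if "i \<in> I" for i
    by (intro torus_bounded_mult u h_bp that)
  have int: "integrable torus v" if "torus_bounded v" for v using that by (simp add: torus_bounded_def torus_integrable_def)
  have per: "period 1 v" if "torus_bounded v" for v using that by (simp add: torus_bounded_def torus_integrable_def)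

  have "(\<integral>x. u x * ordered_sum I fst (\<lambda>i. avg (primorial_except i) (g i) x) (Suc r) K \<partial>torus)
      = (\<integral>x. (\<Sum>i\<in>J. u x * h i x * O' (fst i) x) \<partial>torus)"
    by (simp add: O'_def J_def h_def sum_distrib_left mult.assoc)
  also have "\<dots> = (\<Sum>i\<in>J. \<integral>x. u x * h i x * O' (fst i) x \<partial>torus)"
    using J by (intro Bochner_Integration.integral_sum int torus_bounded_mult[OF uh_bp O_bp]) blast
  also have "\<dots> \<le> (\<Sum>i\<in>J. moment_const c r (s + c) * (\<integral>x. u x * h i x \<partial>torus))"
  proof (rule sum_mono)
    fix i assume i: "i \<in> J"
    \<comment> \<open>The induction hypothesis is used with weight u times \<open>h i\<close>. Its
      period comes from the gcd of G and the new index; among primes up to \<open>fst i\<close>,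
      this gcd can miss only those in D or \<open>snd i\<close>.\<close>
    let ?G = "gcd G (primorial_except i)" and ?D = "D \<union> snd i"
    have "period (1 / real ?G) (h i)"
      unfolding h_def using per[OF g(1)[of i]] i J primorial_except_pos[of i]
      by (intro period_dvd[OF period_avg]) auto
    moreover have "period (1 / real ?G) u"
      using u by (intro period_dvd[OF u(3)]) auto
    ultimately have "period (1 / real ?G) (\<lambda>x. u x * h i x)" by (simp add: period_def)
    moreover have "card ?D \<le> s + c"
      using card_Un_le[of D "snd i"] D(2) I(2)[of i] i J by fastforce
    moreover have "p dvd ?G" if "prime p" "p \<le> fst i" "p \<notin> ?D" for p
      using that D(3)[of p] i prime_dvd_primorial_except_iff[of p "fst i" "snd i"] by (auto simp: J_def)
    ultimately show "(\<integral>x. u x * h i x * O' (fst i) x \<partial>torus) \<le> moment_const c r (s + c) * (\<integral>x. u x * h i x \<partial>torus)"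
      unfolding O'_def h_def
      using i J I(2)[of i] D(1) u primorial_except_pos[of i] uh_bp[of i] h_nonneg
      by (intro Suc.IH[where G = ?G and D = ?D]) (auto simp: h_def)
  qed
  also have "\<dots> = moment_const c r (s + c) * (\<Sum>i\<in>J. \<integral>x. u x * h i x \<partial>torus)"
    by (simp add: sum_distrib_left)
  \<comment> \<open>As u has period 1/G, a further average over G is free; composed with the average
    in \<open>h i\<close> it becomes one average over the lcm.\<close>
  also have "(\<Sum>i\<in>J. \<integral>x. u x * h i x \<partial>torus) = (\<Sum>i\<in>J. \<integral>x. u x * avg (lcm G (primorial_except i)) (g i) x \<partial>torus)"
  proof (rule sum.cong[OF refl])
    fix i assume i: "i \<in> J"
    then have gi: "torus_bounded (g i)" by (rule g_bp)
    have "(\<integral>x. u x * h i x \<partial>torus) = (\<integral>x. u x * avg G (h i) x \<partial>torus)"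
      using h_bp[of i] i J by (intro integral_period_avg u) (auto simp: torus_bounded_def)
    then show "(\<integral>x. u x * h i x \<partial>torus) = (\<integral>x. u x * avg (lcm G (primorial_except i)) (g i) x \<partial>torus)"
      unfolding h_def avg_avg[OF per[OF gi] u(4) primorial_except_pos] .
  qed
  also have "\<dots> = (\<integral>x. (\<Sum>i\<in>J. u x * avg (lcm G (primorial_except i)) (g i) x) \<partial>torus)"
    by (intro Bochner_Integration.integral_sum[symmetric] int torus_bounded_mult u torus_bounded_avg g_bp)
  \<comment> \<open>Although J may be large, at most 2^s distinct lcms occur, and each contributes
    at most 1.\<close>
  also have "\<dots> \<le> (\<integral>x. 2 ^ s * u x \<partial>torus)"
  proof (rule integral_mono)
    show "integrable torus (\<lambda>x. \<Sum>i\<in>J. u x * avg (lcm G (primorial_except i)) (g i) x)"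
      by (intro Bochner_Integration.integrable_sum int torus_bounded_mult u torus_bounded_avg g_bp)
    show "integrable torus (\<lambda>x. 2 ^ s * u x)" using int[OF u(1)] by simp
    fix x
    have "(\<Sum>i\<in>J. g i x) \<le> 1" for x
      using sum_mono2[OF I(1) J(2), of "\<lambda>i. g i x"] g(2) g(3)[of x] by fastforce
    then have "(\<Sum>i\<in>J. avg (lcm G (primorial_except i)) (g i) x) \<le> real (card ((\<lambda>i. lcm G (primorial_except i)) ` J))"
      using J u(4) primorial_except_pos g by (intro sum_avg_le_card) (auto simp: lcm_pos_nat)
    also have "\<dots> \<le> 2 ^ card D"
      using card_lcm_primorial_except[OF D(1,3), of K J] by (auto simp: J_def)
    also have "\<dots> \<le> 2 ^ s" using D(2) by (intro power_increasing) auto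
    finally show "(\<Sum>i\<in>J. u x * avg (lcm G (primorial_except i)) (g i) x) \<le> 2 ^ s * u x"
      unfolding sum_distrib_left[symmetric] using u(2)[of x] by (metis mult.commute mult_left_mono)
  qed
  also have "\<dots> = 2 ^ s * (\<integral>x. u x \<partial>torus)" by simp
  finally show ?case using moment_const_pos[of c r "s + c"] by (simp add: mult_ac mult_left_mono)
qed

text \<open>The factor with the largest cutoff is split off first and becomes the initial weight.
  Starting from weight 1 would leave a mere constant on the right; this way the integral of the sum
  of the \<open>g i\<close> survives, which the weak type bound needs.\<close>

lemma integral_power_sum_avg_le:
  fixes I :: "(nat \<times> nat set) set" and g :: "nat \<times> nat set \<Rightarrow> real \<Rightarrow> real"
  assumes I: "finite I" "\<And>i. i \<in> I \<Longrightarrow> finite (snd i) \<and> card (snd i) \<le> c"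
    and g: "\<And>i. i \<in> I \<Longrightarrow> torus_bounded (g i)" "\<And>i x. g i x \<ge> 0" "\<And>x. (\<Sum>i\<in>I. g i x) \<le> 1"
  shows "(\<integral>x. (\<Sum>i\<in>I. avg (primorial_except i) (g i) x) ^ Suc r \<partial>torus)
           \<le> fact (Suc r) * moment_const c r c * (\<integral>x. (\<Sum>i\<in>I. g i x) \<partial>torus)"
proof -
  define h where "h = (\<lambda>i. avg (primorial_except i) (g i))"
  define O' where "O' = (\<lambda>r K x. ordered_sum I fst (\<lambda>i. h i x) r K)"
  obtain K where K: "\<And>i. i \<in> I \<Longrightarrow> fst i \<le> K"
    using I(1) by (metis finite_imageI finite_nat_set_iff_bounded_le image_eqI)
  then have IK: "{i. i \<in> I \<and> fst i \<le> K} = I" by auto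
  have h_bp: "torus_bounded (h i)" if "i \<in> I" for i
    unfolding h_def by (intro torus_bounded_avg g that)
  have h_nonneg: "h i x \<ge> 0" for i x
    unfolding h_def by (intro avg_nonneg g)
  have O_bp: "torus_bounded (O' r K)" for r K
    unfolding O'_def by (intro torus_bounded_ordered_sum h_bp)
  have int: "integrable torus v" if "torus_bounded v" for v using that by (simp add: torus_bounded_def torus_integrable_def)
  have per: "period 1 v" if "torus_bounded v" for v using that by (simp add: torus_bounded_def torus_integrable_def)
  have "(\<integral>x. (\<Sum>i\<in>I. h i x) ^ Suc r \<partial>torus) \<le> (\<integral>x. fact (Suc r) * O' (Suc r) K x \<partial>torus)"
  proof (rule integral_mono)
    show "integrable torus (\<lambda>x. (\<Sum>i\<in>I. h i x) ^ Suc r)"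
      by (intro int torus_bounded_power torus_bounded_sum h_bp)
    show "integrable torus (\<lambda>x. fact (Suc r) * O' (Suc r) K x)"
      by (intro int torus_bounded_mult torus_bounded_const O_bp)
    show "(\<Sum>i\<in>I. h i x) ^ Suc r \<le> fact (Suc r) * O' (Suc r) K x" for x
      using power_sum_le_ordered_sum[OF I(1), of "\<lambda>i. h i x" fst K "Suc r"] h_nonneg
      unfolding O'_def IK by auto
  qed
  also have "\<dots> = fact (Suc r) * (\<integral>x. (\<Sum>i\<in>I. h i x * O' r (fst i) x) \<partial>torus)"
    by (simp add: O'_def IK)
  also have "(\<integral>x. (\<Sum>i\<in>I. h i x * O' r (fst i) x) \<partial>torus) = (\<Sum>i\<in>I. \<integral>x. h i x * O' r (fst i) x \<partial>torus)"
    by (intro Bochner_Integration.integral_sum int torus_bounded_mult h_bp O_bp)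
  also have "\<dots> \<le> (\<Sum>i\<in>I. moment_const c r c * (\<integral>x. h i x \<partial>torus))"
  proof (rule sum_mono)
    fix i assume i: "i \<in> I"
    have "period (1 / real (primorial_except i)) (h i)"
      unfolding h_def using i g per primorial_except_pos by (intro period_avg) auto
    then show "(\<integral>x. h i x * O' r (fst i) x \<partial>torus) \<le> moment_const c r c * (\<integral>x. h i x \<partial>torus)"
      unfolding O'_def h_def
      using i I(2)[of i] primorial_except_pos[of i] h_bp[of i] h_nonneg g prime_dvd_primorial_except_iff[of _ "fst i" "snd i"]
      by (intro integral_ordered_sum_le[OF I g, where G = "primorial_except i" and D = "snd i"]) (auto simp: h_def)
  qed
  also have "\<dots> = moment_const c r c * (\<Sum>i\<in>I. \<integral>x. g i x \<partial>torus)"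
    unfolding sum_distrib_left h_def using g primorial_except_pos
    by (intro sum.cong) (auto simp: torus_integrable_avg(2) torus_bounded_def)
  also have "(\<Sum>i\<in>I. \<integral>x. g i x \<partial>torus) = (\<integral>x. (\<Sum>i\<in>I. g i x) \<partial>torus)"
    by (intro Bochner_Integration.integral_sum[symmetric] int g)
  finally show ?thesis by (simp add: h_def mult.assoc)
qed

section \<open>The weak type inequality\<close>

lemma Youngs_inequality_nat:
  fixes a b :: real
  assumes "q \<ge> 2" "a \<ge> 0" "b \<ge> 0"
  shows "a * b \<le> a powr (real q / (real q - 1)) + b ^ q"
proof (cases "b = 0")
  case True
  then show ?thesis using assms by simp
next
  case False
  let ?p = "real q / (real q - 1)"
  have "a * b \<le> a powr ?p / ?p + b powr real q / real q"
    using assms by (intro Youngs_inequality) (auto simp: divide_simps)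
  also have "\<dots> \<le> a powr ?p / 1 + b powr real q / 1"
    using assms by (intro add_mono divide_left_mono) (auto simp: divide_simps)
  finally show ?thesis using False assms by (simp add: powr_realpow)
qed

text \<open>Duality: the indicator of the exceptional set is distributed over functions
  \<open>g i\<close> living where the i-th average exceeds l. Moving the averages onto the
  \<open>g i\<close> gives the integral of H F, which Young's inequality and the moment bound for H
  control. K is fixed before I and F, so it is uniform in the number of indices.\<close>

lemma finite_maximal_inequality:
  fixes q c :: nat and l :: real
  assumes q: "q \<ge> 2" and l: "l > 0"
  obtains K where "K \<ge> 0" and "\<And>I F. finite I \<Longrightarrow> (\<And>i. i \<in> I \<Longrightarrow> finite (snd i) \<and> card (snd i) \<le> c) \<Longrightarrow>
    torus_integrable F \<Longrightarrow> (\<And>x. F x \<ge> 0) \<Longrightarrow> integrable torus (\<lambda>x. F x powr (real q / (real q - 1))) \<Longrightarrow>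
    measure torus {x \<in> {0..<1}. \<exists>i\<in>I. l < avg (primorial_except i) F x}
      \<le> K * (\<integral>x. F x powr (real q / (real q - 1)) \<partial>torus)"
proof -
  define p where "p = real q / (real q - 1)"
  define C where "C = fact q * moment_const c (q - 1) c"
  \<comment> \<open>Young's inequality will be applied to t F and H / t. With this t the moment term
    is at most C / t^q times the measure, hence at most half of the left side, and is absorbed;
    solving for the measure gives K. The lower bound 1 ensures that t is at most t^q.\<close>
  define t where "t = max 1 (2 * C / l)"
  define K where "K = 2 * t powr p / l"
  have C: "C > 0" by (simp add: C_def moment_const_pos)
  have t: "t \<ge> 1" "2 * C / l \<le> t" by (auto simp: t_def)
  have "t \<le> t ^ q" using t q self_le_power[of t q] by simp
  then have tq: "C / t ^ q \<le> l / 2"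
  proof -
    have "C \<le> l / 2 * t" using t(2) l by (simp add: field_simps)
    also have "\<dots> \<le> l / 2 * t ^ q" using \<open>t \<le> t ^ q\<close> l by simp
    finally show ?thesis using t by (simp add: pos_divide_le_eq)
  qed
  have K: "K \<ge> 0" using l by (simp add: K_def)
  have main: "measure torus {x \<in> {0..<1}. \<exists>i\<in>I. l < avg (primorial_except i) F x} \<le> K * (\<integral>x. F x powr p \<partial>torus)"
    if I: "finite I" "\<And>i. i \<in> I \<Longrightarrow> finite (snd i) \<and> card (snd i) \<le> c"
      and F: "torus_integrable F" "\<And>x. F x \<ge> 0" and Fp: "integrable torus (\<lambda>x. F x powr p)" for I F
  proof -
    \<comment> \<open>The indicators of the sets where a single average exceeds \<open>l\<close>, normalised (with \<open>0 / 0 = 0\<close>) to add up to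
      the indicator of their union.\<close>
    define b where "b = (\<lambda>i x. if l < avg (primorial_except i) F x then 1 else 0 :: real)"
    define N where "N = (\<lambda>x. \<Sum>i\<in>I. b i x)"
    define g where "g = (\<lambda>i x. b i x / N x)"
    define H where "H = (\<lambda>x. \<Sum>i\<in>I. avg (primorial_except i) (g i) x)"
    define a where "a = (\<lambda>x. \<Sum>i\<in>I. g i x)"
    define A where "A = {x \<in> {0..<1}. \<exists>i\<in>I. l < avg (primorial_except i) F x}"
    have avg_meas [measurable]: "avg n F \<in> borel_measurable torus" for n
      using torus_integrable_avg(1)[OF F(1)] by (auto simp: torus_integrable_def)
    have A_meas: "A \<in> sets torus"
    proof -
      have "{x \<in> space torus. \<exists>i\<in>I. l < avg (primorial_except i) F x} \<in> sets torus"
        using I(1) by measurable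
      then show ?thesis by (simp add: A_def)
    qed
    have b_meas [measurable]: "b i \<in> borel_measurable torus" for i
      unfolding b_def by measurable
    have N_meas [measurable]: "N \<in> borel_measurable torus" unfolding N_def by measurable
    have g_meas: "g i \<in> borel_measurable torus" for i
      unfolding g_def by measurable
    have b_nonneg: "b i x \<ge> 0" for i x by (simp add: b_def)
    have N_nonneg: "N x \<ge> 0" for x unfolding N_def by (intro sum_nonneg b_nonneg)
    have g_nonneg: "g i x \<ge> 0" for i x using b_nonneg N_nonneg by (simp add: g_def)
    have a_eq: "a x = (if \<exists>i\<in>I. l < avg (primorial_except i) F x then 1 else 0)" for x
    proof (cases "\<exists>i\<in>I. l < avg (primorial_except i) F x")
      case True
      then obtain i where i: "i \<in> I" "b i x = 1" by (auto simp: b_def)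
      then have "N x > 0" unfolding N_def using I(1) b_nonneg by (intro sum_pos2[of I i]) auto
      then have "a x = 1" by (simp add: a_def g_def N_def flip: sum_divide_distrib)
      then show ?thesis using True by simp
    next
      case False
      then have "a x = 0" unfolding a_def g_def b_def by (intro sum.neutral) auto
      then show ?thesis using False by simp
    qed
    have a_le: "a x \<le> 1" for x by (simp add: a_eq)
    have g_bp: "torus_bounded (g i)" if "i \<in> I" for i
    proof (rule torus_boundedI[of _ 1])
      have "period 1 (avg n F)" for n using period_avg_same[of 1 F] F by (simp add: torus_integrable_def)
      then show "period 1 (g i)" by (simp add: g_def N_def b_def period_def)
      show "g i \<in> borel_measurable torus" by (rule g_meas)
      show "\<bar>g i x\<bar> \<le> 1" for x
      proof -
        have "g i x \<le> a x"
          unfolding a_def by (rule member_le_sum) (use that I(1) g_nonneg in auto)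
        then show ?thesis using a_le[of x] g_nonneg[of i x] by linarith
      qed
    qed
    have int: "integrable torus v" if "torus_integrable v" for v using that by (simp add: torus_integrable_def)
    have H_bp: "torus_bounded H" unfolding H_def by (intro torus_bounded_sum torus_bounded_avg g_bp)
    have H_nonneg: "H x \<ge> 0" for x unfolding H_def by (intro sum_nonneg avg_nonneg g_nonneg)
    have a_int: "(\<integral>x. a x \<partial>torus) = measure torus A"
    proof -
      have "(\<integral>x. a x \<partial>torus) = (\<integral>x. indicator A x \<partial>torus)"
        by (intro Bochner_Integration.integral_cong) (auto simp: a_eq A_def)
      then show ?thesis using A_meas sets.sets_into_space[OF A_meas] by (simp add: Int_absorb2)
    qed
    have Hq: "(\<integral>x. H x ^ q \<partial>torus) \<le> C * measure torus A"
    proof -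
      have "(\<integral>x. H x ^ Suc (q - 1) \<partial>torus) \<le> fact (Suc (q - 1)) * moment_const c (q - 1) c * (\<integral>x. a x \<partial>torus)"
        unfolding H_def a_def by (rule integral_power_sum_avg_le) (use I g_bp g_nonneg a_le in \<open>auto simp: a_def\<close>)
      then show ?thesis using q by (simp add: C_def a_int)
    qed
    have gF: "torus_integrable (\<lambda>x. g i x * avg (primorial_except i) F x)" if "i \<in> I" for i
      by (intro torus_integrable_mult g_bp torus_integrable_avg F that)
    have "l * measure torus A = (\<integral>x. l * a x \<partial>torus)" by (simp add: a_int)
    also have "\<dots> \<le> (\<integral>x. (\<Sum>i\<in>I. g i x * avg (primorial_except i) F x) \<partial>torus)"
    proof (rule integral_mono)
      show "integrable torus (\<lambda>x. l * a x)"
        unfolding a_def using g_bp by (intro integrable_mult_right Bochner_Integration.integrable_sum) (auto simp: torus_bounded_def int)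
      show "integrable torus (\<lambda>x. \<Sum>i\<in>I. g i x * avg (primorial_except i) F x)"
        by (intro Bochner_Integration.integrable_sum int gF)
      show "l * a x \<le> (\<Sum>i\<in>I. g i x * avg (primorial_except i) F x)" for x
        unfolding a_def sum_distrib_left using N_nonneg[of x]
        by (intro sum_mono) (auto simp: g_def b_def divide_right_mono)
    qed
    also have "\<dots> = (\<Sum>i\<in>I. \<integral>x. g i x * avg (primorial_except i) F x \<partial>torus)"
      by (intro Bochner_Integration.integral_sum int gF)
    also have "\<dots> = (\<Sum>i\<in>I. \<integral>x. avg (primorial_except i) (g i) x * F x \<partial>torus)"
      by (intro sum.cong refl integral_avg_adjoint g_bp F primorial_except_pos)
    also have "\<dots> = (\<integral>x. H x * F x \<partial>torus)"
      unfolding H_def sum_distrib_right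
      by (intro Bochner_Integration.integral_sum[symmetric] int torus_integrable_mult torus_bounded_avg g_bp F)
    also have "\<dots> \<le> (\<integral>x. t powr p * F x powr p + 1 / t ^ q * H x ^ q \<partial>torus)"
    proof (rule integral_mono)
      show "integrable torus (\<lambda>x. H x * F x)" by (intro int torus_integrable_mult H_bp F)
      show "integrable torus (\<lambda>x. t powr p * F x powr p + 1 / t ^ q * H x ^ q)"
        using torus_bounded_power[OF H_bp, of q]
        by (intro Bochner_Integration.integrable_add integrable_mult_right Fp) (auto simp: torus_bounded_def int)
      show "H x * F x \<le> t powr p * F x powr p + 1 / t ^ q * H x ^ q" for x
        using Youngs_inequality_nat[OF q, of "t * F x" "H x / t"] t F(2)[of x] H_nonneg[of x]
        by (simp add: powr_mult power_divide p_def mult.commute)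
    qed
    also have "\<dots> = t powr p * (\<integral>x. F x powr p \<partial>torus) + 1 / t ^ q * (\<integral>x. H x ^ q \<partial>torus)"
      using Fp torus_bounded_power[OF H_bp, of q] by (subst Bochner_Integration.integral_add) (auto simp: torus_bounded_def int)
    also have "1 / t ^ q * (\<integral>x. H x ^ q \<partial>torus) \<le> 1 / t ^ q * (C * measure torus A)"
      using t Hq by (intro mult_left_mono) auto
    also have "\<dots> \<le> l / 2 * measure torus A"
      using mult_right_mono[OF tq, of "measure torus A"] by simp
    finally have "l / 2 * measure torus A \<le> t powr p * (\<integral>x. F x powr p \<partial>torus)" by simp
    then show ?thesis unfolding A_def[symmetric] K_def using l by (simp add: field_simps)
  qed
  show ?thesis by (rule that[OF K main[unfolded p_def]])
qed

section \<open>Infinite dimension\<close>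

text \<open>The omitted a and b range over all naturals; a choice such as a = b = 0 removes no
  prime, so the full primorials belong to the set and make it infinite.\<close>

definition near_primorials :: "nat set" where
  "near_primorials = range (\<lambda>(y, a, b). primorial_except (y, {a, b}))"

text \<open>Attach to each vertex the set of colours of its pairs with larger vertices. By
  pigeonhole some i < j have equal sets, so the colour of (i,j) also occurs on a pair starting at
  j.\<close>

lemma exists_equally_coloured_path:
  fixes X :: "nat set" and col :: "nat \<Rightarrow> nat \<Rightarrow> 'c"
  assumes "finite D" "\<And>i j. col i j \<in> D" "finite X" "card X > 2 ^ card D"
  obtains i j l where "i \<in> X" "j \<in> X" "l \<in> X" "i < j" "j < l" "col i j = col j l"
proof -
  let ?f = "\<lambda>i. {col i j | j. j \<in> X \<and> i < j}"
  have "?f ` X \<subseteq> Pow D" using assms(2) by auto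
  then have "card (?f ` X) < card X"
    using card_mono[of "Pow D" "?f ` X"] assms(1,4) by (simp add: card_Pow)
  then have "\<not> inj_on ?f X" by (rule pigeonhole)
  then obtain i j where "i \<in> X" "j \<in> X" "i \<noteq> j" "?f i = ?f j"
    unfolding inj_on_def by blast
  then obtain i j where ij: "i \<in> X" "j \<in> X" "i < j" and f: "?f i = ?f j"
    using that by (cases "i < j") (auto simp: not_less)
  have "col i j \<in> ?f i" using ij by blast
  then have "col i j \<in> ?f j" unfolding f .
  then show ?thesis using that ij by blast
qed

lemma not_covered_near_primorials: "\<not> covered_by_chains near_primorials d"
proof
  assume "covered_by_chains near_primorials d"
  then obtain S where S: "\<And>i. i \<in> {1..d} \<Longrightarrow> chain (S i)" "near_primorials \<subseteq> lcm_set d S"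
    unfolding covered_by_chains_def by blast
  have "\<exists>s. \<forall>k\<in>{1..d}. strict_mono (s k) \<and> (\<forall>t. s k t dvd s k (Suc t)) \<and> S k = range (s k)"
    using S(1) unfolding chain_def by (intro bchoice) blast
  then obtain s where s: "\<And>k t. k \<in> {1..d} \<Longrightarrow> s k t dvd s k (Suc t)" "\<And>k. k \<in> {1..d} \<Longrightarrow> S k = range (s k)"
    by blast
  have s_dvd: "s k t dvd s k t'" if "k \<in> {1..d}" "t \<le> t'" for k t t'
    using that(2) by (induction t' rule: dec_induct) (use s(1)[OF that(1)] dvd_trans in auto)
  \<comment> \<open>The sets \<open>U k p\<close> are upward closed, hence linearly ordered by inclusion for fixed \<open>k\<close>.\<close>
  define U where "U = (\<lambda>k p. {t. p dvd s k t})"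
  define col where "col = (\<lambda>i j. {k \<in> {1..d}. U k j \<subseteq> U k i})"
  \<comment> \<open>Colours are subsets of {1..d}, so this is one more vertex than there are sets of
    colours.\<close>
  obtain X where X: "finite X" "card X = Suc (2 ^ card (Pow {1..d}))" "X \<subseteq> {p :: nat. prime p}"
    using primes_infinite infinite_arbitrarily_large by blast
  obtain i j l where ijl: "i \<in> X" "j \<in> X" "l \<in> X" "i < j" "j < l" and col: "col i j = col j l"
    by (rule exists_equally_coloured_path[of "Pow {1..d}" col X]) (use X in \<open>auto simp: col_def\<close>)
  have prime: "prime i" "prime j" "prime l" using ijl X by auto
  \<comment> \<open>This member is divisible by the middle prime j but by neither i nor l. The chain
    element through which j enters the lcm then has the same property.\<close>
  let ?n = "primorial_except (l, {i, l})"
  have "?n \<in> lcm_set d S" using S(2) rangeI[of "\<lambda>(y, a, b). primorial_except (y, {a, b})" "(l, i, l)"] by (auto simp: near_primorials_def)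
  then obtain m where m: "?n = (LCM k\<in>{1..d}. m k)" "\<And>k. k \<in> {1..d} \<Longrightarrow> m k \<in> S k"
    by (auto simp: lcm_set_def)
  have "j dvd ?n" "\<not> i dvd ?n" "\<not> l dvd ?n"
    using prime ijl by (simp_all add: prime_dvd_primorial_except_iff)
  have "?n dvd (\<Prod>k\<in>{1..d}. m k)" unfolding m(1) by (intro Lcm_least) auto
  with \<open>j dvd ?n\<close> have "j dvd (\<Prod>k\<in>{1..d}. m k)" by (rule dvd_trans)
  then obtain k where k: "k \<in> {1..d}" "j dvd m k"
    using prime_dvd_prod_iff[of "{1..d}" j m] prime by auto
  obtain t where t: "m k = s k t" using m(2)[OF k(1)] s(2)[OF k(1)] by auto
  have "m k dvd ?n" unfolding m(1) using k by (intro dvd_Lcm) auto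
  then have tU: "t \<in> U k j" "t \<notin> U k i" "t \<notin> U k l"
    using k t \<open>\<not> i dvd ?n\<close> \<open>\<not> l dvd ?n\<close> dvd_trans by (auto simp: U_def)
  \<comment> \<open>Chain k places j strictly before i, so k is missing from the colour of (i,j) and
    hence from that of (j,l). Thus some t' has l but not j, while t has j but not l, contradicting
    the linear order of the sets \<open>U k p\<close>.\<close>
  then have "k \<notin> col i j" by (auto simp: col_def)
  then have "\<not> U k l \<subseteq> U k j" using col k by (auto simp: col_def)
  then obtain t' where t': "t' \<in> U k l" "t' \<notin> U k j" by blast
  show False
  proof (cases "t \<le> t'")
    case True
    then show ?thesis using s_dvd[OF k(1) True] t' tU by (auto simp: U_def dest: dvd_trans)
  next
    case False
    then show ?thesis using s_dvd[OF k(1), of t' t] t' tU by (auto simp: U_def dest: dvd_trans)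
  qed
qed

lemma infinite_near_primorials: "infinite near_primorials"
proof
  assume "finite near_primorials"
  then obtain B where B: "\<And>n. n \<in> near_primorials \<Longrightarrow> n \<le> B"
    by (meson finite_nat_set_iff_bounded_le)
  obtain p where p: "prime p" "p > B" using bigger_prime by blast
  have "primorial_except (p, {0, 0}) \<in> near_primorials" unfolding near_primorials_def by (rule range_eqI[of _ _ "(p, 0, 0)"]) simp
  moreover have "p dvd primorial_except (p, {0, 0})"
    using p prime_dvd_primorial_except_iff[of p p "{0, 0}"] prime_gt_0_nat[OF p(1)] by simp
  ultimately show False using B[of "primorial_except (p, {0, 0})"] p dvd_imp_le[of p "primorial_except (p, {0, 0})"] primorial_except_pos[of "(p, {0, 0})"] by linarith
qed

section \<open>Almost everywhere convergence\<close>

text \<open>The exceptional sets for d = 1/(k+1) intersect in a null set, and P holds everywhere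
  outside it.\<close>

lemma AE_torus_if_small_exceptions:
  assumes "\<And>d :: real. d > 0 \<Longrightarrow> \<exists>A\<in>sets torus. measure torus A \<le> d \<and> (\<forall>x\<in>{0..<1} - A. P x)"
  shows "AE x in torus. P x"
proof -
  interpret finite_measure torus by (rule finite_measure_torus)
  have "\<exists>A. \<forall>k. A k \<in> sets torus \<and> measure torus (A k) \<le> 1 / real (Suc k) \<and> (\<forall>x\<in>{0..<1} - A k. P x)"
    using assms[of "1 / real (Suc k)" for k] by (intro choice) auto
  then obtain A where A: "\<And>k. A k \<in> sets torus" "\<And>k. measure torus (A k) \<le> 1 / real (Suc k)"
    "\<And>k x. x \<in> {0..<1} - A k \<Longrightarrow> P x" by blast
  define N where "N = (\<Inter>k. A k)"
  have N: "N \<in> sets torus" unfolding N_def using A(1) by auto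
  have "measure torus N \<le> 1 / real (Suc k)" for k
    using finite_measure_mono[of N "A k"] A by (force simp: N_def intro: order_trans)
  then have "measure torus N \<le> 0"
    using LIMSEQ_le_const[OF LIMSEQ_inverse_real_of_nat] by (simp add: inverse_eq_divide)
  then have "emeasure torus N = 0"
    by (simp add: emeasure_eq_measure measure_le_0_iff)
  then show ?thesis using A(3) N by (intro AE_I[of _ _ N]) (auto simp: N_def)
qed

text \<open>Passage from finite to countable families: the exceptional sets of the first N indices
  increase with N, and their measures share one bound because K is uniform.\<close>

lemma maximal_inequality:
  fixes q c :: nat and l :: real
  assumes q: "q \<ge> 2" and l: "l > 0"
  obtains K where "K \<ge> 0" and "\<And>I F. countable I \<Longrightarrow> (\<And>i. i \<in> I \<Longrightarrow> finite (snd i) \<and> card (snd i) \<le> c) \<Longrightarrow>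
    torus_integrable F \<Longrightarrow> (\<And>x. F x \<ge> 0) \<Longrightarrow> integrable torus (\<lambda>x. F x powr (real q / (real q - 1))) \<Longrightarrow>
    \<exists>A\<in>sets torus. measure torus A \<le> K * (\<integral>x. F x powr (real q / (real q - 1)) \<partial>torus) \<and>
      (\<forall>x\<in>{0..<1} - A. \<forall>i\<in>I. avg (primorial_except i) F x \<le> l)"
proof -
  interpret finite_measure torus by (rule finite_measure_torus)
  obtain K where K: "K \<ge> 0" "\<And>I F. finite I \<Longrightarrow> (\<And>i. i \<in> I \<Longrightarrow> finite (snd i) \<and> card (snd i) \<le> c) \<Longrightarrow>
    torus_integrable F \<Longrightarrow> (\<And>x. F x \<ge> 0) \<Longrightarrow> integrable torus (\<lambda>x. F x powr (real q / (real q - 1))) \<Longrightarrow>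
    measure torus {x \<in> {0..<1}. \<exists>i\<in>I. l < avg (primorial_except i) F x}
      \<le> K * (\<integral>x. F x powr (real q / (real q - 1)) \<partial>torus)"
    by (rule finite_maximal_inequality[OF assms, of c]) blast
  have "\<exists>A\<in>sets torus. measure torus A \<le> K * (\<integral>x. F x powr (real q / (real q - 1)) \<partial>torus) \<and>
      (\<forall>x\<in>{0..<1} - A. \<forall>i\<in>I. avg (primorial_except i) F x \<le> l)"
    if I: "countable I" "\<And>i. i \<in> I \<Longrightarrow> finite (snd i) \<and> card (snd i) \<le> c"
      and F: "torus_integrable F" "\<And>x. F x \<ge> 0" "integrable torus (\<lambda>x. F x powr (real q / (real q - 1)))" for I F
  proof (cases "I = {}")
    case True
    then show ?thesis using K(1) by (intro bexI[of _ "{}"]) (auto intro!: mult_nonneg_nonneg)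
  next
    case False
    define e where "e = from_nat_into I"
    have e: "range e = I" unfolding e_def using False I(1) by (rule range_from_nat_into)
    define A where "A = (\<lambda>N. {x \<in> {0..<1}. \<exists>i\<in>e ` {..<N}. l < avg (primorial_except i) F x})"
    have [measurable]: "avg n F \<in> borel_measurable torus" for n
      using torus_integrable_avg(1)[OF F(1)] by (auto simp: torus_integrable_def)
    have A_meas: "A N \<in> sets torus" for N
    proof -
      have "{x \<in> space torus. \<exists>i\<in>e ` {..<N}. l < avg (primorial_except i) F x} \<in> sets torus"
        by measurable
      then show ?thesis by (simp add: A_def)
    qed
    have inc: "incseq A" by (force simp: incseq_def A_def)
    have "measure torus (A N) \<le> K * (\<integral>x. F x powr (real q / (real q - 1)) \<partial>torus)" for N
      unfolding A_def using I(2) F e by (intro K(2)) auto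
    moreover have "(\<lambda>N. measure torus (A N)) \<longlonglongrightarrow> measure torus (\<Union>N. A N)"
      using A_meas inc by (intro finite_Lim_measure_incseq) auto
    ultimately have "measure torus (\<Union>N. A N) \<le> K * (\<integral>x. F x powr (real q / (real q - 1)) \<partial>torus)"
      by (intro LIMSEQ_le_const2) auto
    moreover have "avg (primorial_except i) F x \<le> l" if x: "x \<in> {0..<1} - (\<Union>N. A N)" and i: "i \<in> I" for x i
    proof -
      obtain k where k: "i = e k" using i e by auto
      have "x \<notin> A (Suc k)" using x by blast
      moreover have "e k \<in> e ` {..<Suc k}" by blast
      ultimately have "\<not> l < avg (primorial_except (e k)) F x" using x unfolding A_def by blast
      then show ?thesis by (simp add: k)
    qed
    ultimately show ?thesis using A_meas by (intro bexI[of _ "\<Union>N. A N"]) auto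
  qed
  then show ?thesis by (rule that[OF K(1)])
qed

text \<open>For large n the function \<open>avg n G\<close> oscillates by at most e/2, so averaging
  it again over m changes it by at most e/2. As the two averages commute, the double average is
  close to both \<open>avg n G\<close> and \<open>avg m G\<close>; the integral of G never
  enters.\<close>

lemma uniform_Cauchy_avg:
  assumes G: "continuous_on UNIV G" "period 1 G" and e: "e > 0"
  shows "\<exists>N. \<forall>n\<ge>N. \<forall>m\<ge>N. \<forall>x. \<bar>avg n G x - avg m G x\<bar> \<le> e"
proof -
  \<comment> \<open>The points compared are frac x and frac x + s with 0 <= s < 1, which both lie in
    [0,2).\<close>
  have "uniformly_continuous_on {-1..2} G"
    using G by (intro compact_uniformly_continuous continuous_on_subset[OF G(1)]) auto
  then obtain d where d: "d > 0"
    "\<And>x y. x \<in> {-1..2} \<Longrightarrow> y \<in> {-1..2} \<Longrightarrow> \<bar>y - x\<bar> < d \<Longrightarrow> \<bar>G y - G x\<bar> < e / 2"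
    using e unfolding uniformly_continuous_on_def dist_real_def by (metis half_gt_zero)
  have close: "\<bar>G (x + s) - G x\<bar> \<le> e / 2" if s: "0 \<le> s" "s < min d 1" for x s
  proof -
    have "G x = G (frac x)" "G (x + s) = G (frac x + s)"
      using period_int_multiple[OF G(2), of "frac x" "\<lfloor>x\<rfloor>"] period_int_multiple[OF G(2), of "frac x + s" "\<lfloor>x\<rfloor>"]
      by (simp_all add: frac_def)
    moreover have "\<bar>G (frac x + s) - G (frac x)\<bar> < e / 2"
      using s frac_lt_1[of x] frac_ge_0[of x] by (intro d(2)) (auto simp del: frac_ge_0)
    ultimately show ?thesis by simp
  qed
  define N where "N = Suc (nat \<lceil>1 / min d 1\<rceil>)"
  have avg_close: "\<bar>avg m (avg n G) x - avg n G x\<bar> \<le> e / 2" if n: "n \<ge> N" and m: "m > 0" for n m x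
  proof -
    have n0: "n > 0" using n by (simp add: N_def)
    have "1 / min d 1 < real n" using n unfolding N_def by linarith
    then have nd: "1 / real n < min d 1" using d(1) n0 by (simp add: field_simps min_def split: if_splits)
    have osc: "\<bar>avg n G (y + t) - avg n G y\<bar> \<le> e / 2" for y t
    proof -
      \<comment> \<open>The average has period 1/n, so t may be replaced by its remainder modulo
        1/n, a shift small enough for \<open>close\<close>.\<close>
      define s where "s = t - of_int \<lfloor>t * real n\<rfloor> * (1 / real n)"
      have s: "s = frac (t * real n) / real n" using n0 by (simp add: s_def frac_def field_simps)
      have "s \<le> 1 / real n" using frac_lt_1[of "t * real n"] unfolding s by (intro divide_right_mono) auto
      then have s': "0 \<le> s" "s < min d 1" using nd by (auto simp: s)
      have "avg n G (y + t) = avg n G (y + s)"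
        using period_int_multiple[OF period_avg[OF G(2) n0], of "y + s" "\<lfloor>t * real n\<rfloor>"]
        by (simp add: s_def)
      also have "\<dots> = avg n (\<lambda>z. G (z + s)) y" by (simp add: avg_def algebra_simps)
      finally have "\<bar>avg n G (y + t) - avg n G y\<bar> \<le> avg n (\<lambda>z. \<bar>G (z + s) - G z\<bar>) y"
        using avg_abs_diff_le[of n "\<lambda>z. G (z + s)" y G] by simp
      also have "\<dots> \<le> e / 2" using close[OF s'] n0 by (intro avg_le) auto
      finally show ?thesis .
    qed
    have "\<bar>avg m (avg n G) x - avg m (\<lambda>_. avg n G x) x\<bar>
        = \<bar>(\<Sum>k<m. avg n G (x + real k / real m) - avg n G x) / real m\<bar>"
      by (simp add: avg_def[of m] sum_subtractf diff_divide_distrib)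
    also have "\<dots> \<le> (\<Sum>k<m. e / 2) / real m"
      unfolding abs_divide by (simp only: abs_of_nat) (intro divide_right_mono order_trans[OF sum_abs] sum_mono osc, simp)
    also have "\<dots> = e / 2" using m by simp
    finally show ?thesis using m by (simp add: avg_def[of m "\<lambda>_. avg n G x"])
  qed
  have "\<bar>avg n G x - avg m G x\<bar> \<le> e" if "n \<ge> N" "m \<ge> N" for n m x
  proof -
    have "n > 0" "m > 0" using that by (auto simp: N_def)
    then have "\<bar>avg m (avg n G) x - avg n G x\<bar> \<le> e / 2" "\<bar>avg m (avg n G) x - avg m G x\<bar> \<le> e / 2"
      using avg_close[of n m x] avg_close[of m n x] that by (auto simp: avg_commute[of m n G])
    then show ?thesis by linarith
  qed
  then show ?thesis by blast
qed

section \<open>Density of continuous periodic functions in L^p\<close>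

lemma borel_measurable_torus: "continuous_on UNIV G \<Longrightarrow> G \<in> borel_measurable torus" for G :: "real \<Rightarrow> real"
  unfolding torus_def
  by (intro measurable_restrict_space1 measurable_completion) (simp add: borel_measurable_continuous_onI)

text \<open>Composition with \<open>frac\<close> makes g periodic but may create jumps at the
  integers. The squared sine vanishes there and, the clamped factor being bounded by M, squeezes the
  product to 0. As n grows the cutoff tends to 1 off the integers.\<close>

lemma continuous_periodic_cutoff:
  fixes g :: "real \<Rightarrow> real" and n :: nat
  assumes g: "continuous_on UNIV g" and M: "M \<ge> 0"
  defines "G \<equiv> \<lambda>x. max (-M) (min M (g (frac x))) * min 1 (real n * (sin (pi * x))\<^sup>2)"
  shows "continuous_on UNIV G" "period 1 G" "\<bar>G x\<bar> \<le> M"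
proof -
  have bound: "\<bar>max (-M) (min M (g (frac x)))\<bar> \<le> M" for x using M by auto
  have cut: "0 \<le> min 1 (real n * (sin (pi * x))\<^sup>2)" "min 1 (real n * (sin (pi * x))\<^sup>2) \<le> 1" for x by auto
  show "\<bar>G x\<bar> \<le> M"
    unfolding G_def abs_mult using mult_mono[OF bound[of x] cut(2)[of x]] cut(1)[of x] M by simp
  have "(sin (pi * (x + 1)))\<^sup>2 = (sin (pi * x))\<^sup>2" for x
    by (simp add: distrib_left)
  moreover have "frac (x + 1) = frac x" for x :: real using frac_1_eq by blast
  ultimately show "period 1 G" by (simp add: G_def period_def)
  have "isCont G x" for x
  proof (cases "x \<in> \<int>")
    case False
    have "isCont frac x" using continuous_frac[OF False] .
    moreover have "isCont g (frac x)" using g by (simp add: continuous_on_eq_continuous_at)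
    ultimately have "isCont (\<lambda>x. g (frac x)) x" by (rule isCont_o2)
    then show ?thesis unfolding G_def by (intro continuous_intros) auto
  next
    case True
    then have sin0: "sin (pi * x) = 0" by (auto simp: Ints_def sin_zero_iff_int2)
    have "isCont (\<lambda>y. M * (real n * (sin (pi * y))\<^sup>2)) x" by (intro continuous_intros)
    then have "((\<lambda>y. M * (real n * (sin (pi * y))\<^sup>2)) \<longlongrightarrow> 0) (at x)"
      using sin0 by (simp add: isCont_def)
    moreover have "norm (G y) \<le> M * (real n * (sin (pi * y))\<^sup>2)" for y
      unfolding G_def real_norm_def abs_mult using bound[of y] M cut[of y] by (intro mult_mono) auto
    ultimately have "(G \<longlongrightarrow> 0) (at x)"
      by (intro Lim_null_comparison[of G]) (auto intro: always_eventually)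
    then show ?thesis using sin0 by (simp add: isCont_def G_def)
  qed
  then show "continuous_on UNIV G" by (simp add: continuous_on_eq_continuous_at)
qed

text \<open>Lebesgue measurability provides continuous functions converging to F almost everywhere.
  Their periodic cutoffs still converge almost everywhere and stay within [-M, M], so dominated
  convergence applies with the constant (2M)^p.\<close>

lemma bounded_approx:
  fixes F :: "real \<Rightarrow> real"
  assumes F: "F \<in> borel_measurable torus" "\<And>x. \<bar>F x\<bar> \<le> M" and p: "p > 0" and d: "d > 0"
  obtains G where "continuous_on UNIV G" "period 1 G" "\<And>x. \<bar>G x\<bar> \<le> M"
    "(\<integral>x. \<bar>F x - G x\<bar> powr p \<partial>torus) < d"
proof -
  have M: "M \<ge> 0" using F(2)[of 0] by simp
  have "F measurable_on {0..<1}"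
    using F(1) by (simp add: torus_def measurable_on_iff_borel_measurable)
  then obtain N g where N: "negligible N" and g: "\<And>n. continuous_on UNIV (g n)"
    "\<And>x. x \<notin> N \<Longrightarrow> (\<lambda>n. g n x) \<longlonglongrightarrow> (if x \<in> {0..<1} then F x else 0)"
    unfolding measurable_on_def by blast
  define G where "G = (\<lambda>n x. max (-M) (min M (g n (frac x))) * min 1 (real n * (sin (pi * x))\<^sup>2))"
  have G: "continuous_on UNIV (G n)" "period 1 (G n)" "\<bar>G n x\<bar> \<le> M" for n x
    unfolding G_def by (rule continuous_periodic_cutoff[OF g(1)[of n] M])+
  have lim: "(\<lambda>n. G n x) \<longlonglongrightarrow> F x" if x: "x \<in> {0<..<1}" "x \<notin> N" for x
  proof -
    have "frac x = x" using x by (simp add: frac_eq)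
    moreover have "(\<lambda>n. max (-M) (min M (g n x))) \<longlonglongrightarrow> max (-M) (min M (F x))"
      using g(2)[OF x(2)] x by (intro tendsto_intros) auto
    moreover have "max (-M) (min M (F x)) = F x" using F(2)[of x] by linarith
    moreover have "(\<lambda>n. min 1 (real n * (sin (pi * x))\<^sup>2)) \<longlonglongrightarrow> 1"
    proof (rule tendsto_eventually)
      have "sin (pi * x) > 0" using x by (intro sin_gt_zero) auto
      then have s: "(sin (pi * x))\<^sup>2 > 0" by simp
      show "\<forall>\<^sub>F n in sequentially. min 1 (real n * (sin (pi * x))\<^sup>2) = 1"
        using eventually_ge_at_top[of "nat \<lceil>1 / (sin (pi * x))\<^sup>2\<rceil>"]
      proof eventually_elim
        case (elim n)
        then have "1 / (sin (pi * x))\<^sup>2 \<le> real n" by linarith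
        then show ?case using s by (simp add: field_simps min_def)
      qed
    qed
    ultimately show ?thesis unfolding G_def using tendsto_mult by fastforce
  qed
  have AE: "AE x in torus. x \<in> {0<..<1} \<and> x \<notin> N"
  proof -
    have "negligible (insert 0 N)" using N by simp
    then have "AE x in lebesgue. x \<notin> insert 0 N"
      by (intro AE_not_in) (simp add: negligible_iff_null_sets)
    then have "AE x in torus. x \<notin> insert 0 N"
      unfolding torus_def by (subst AE_restrict_space_iff) auto
    moreover have "AE x in torus. x \<in> space torus" by (rule AE_space)
    ultimately show ?thesis by eventually_elim (auto simp: less_le)
  qed
  have "(\<lambda>n. \<integral>x. \<bar>F x - G n x\<bar> powr p \<partial>torus) \<longlonglongrightarrow> (\<integral>x. 0 \<partial>torus)"
  proof (rule integral_dominated_convergence)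
    show "(\<lambda>x. \<bar>F x - G n x\<bar> powr p) \<in> borel_measurable torus" for n
      using F(1) borel_measurable_torus[OF G(1)[of n]] by simp
    show "integrable torus (\<lambda>x. (2 * M) powr p)"
      using finite_measure.integrable_const[OF finite_measure_torus] .
    show "AE x in torus. (\<lambda>n. \<bar>F x - G n x\<bar> powr p) \<longlonglongrightarrow> 0"
      using AE
    proof eventually_elim
      case (elim x)
      then have "(\<lambda>n. \<bar>F x - G n x\<bar>) \<longlonglongrightarrow> \<bar>F x - F x\<bar>" by (intro tendsto_intros lim) auto
      then have "(\<lambda>n. \<bar>F x - G n x\<bar> powr p) \<longlonglongrightarrow> 0 powr p"
        using p by (intro tendsto_powr') auto
      then show ?case by simp
    qed
    show "AE x in torus. norm (\<bar>F x - G n x\<bar> powr p) \<le> (2 * M) powr p" for n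
    proof (rule AE_I2)
      fix x
      have "\<bar>F x - G n x\<bar> \<le> 2 * M" using F(2)[of x] G(3)[of n x] by linarith
      then show "norm (\<bar>F x - G n x\<bar> powr p) \<le> (2 * M) powr p" using p by (simp add: powr_mono2)
    qed
  qed simp
  then have "\<forall>\<^sub>F n in sequentially. (\<integral>x. \<bar>F x - G n x\<bar> powr p \<partial>torus) < d"
    using d by (intro order_tendstoD(2)) auto
  then obtain n where "(\<integral>x. \<bar>F x - G n x\<bar> powr p \<partial>torus) < d"
    by (auto simp: eventually_sequentially)
  then show ?thesis using that[of "G n"] G by blast
qed

lemma powr_add_le:
  fixes a b :: real
  assumes "a \<ge> 0" "b \<ge> 0" "p > 0"
  shows "(a + b) powr p \<le> 2 powr p * (a powr p + b powr p)"
proof -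
  have "(a + b) powr p \<le> (2 * max a b) powr p" using assms by (intro powr_mono2) auto
  also have "\<dots> = 2 powr p * max a b powr p" using assms by (simp add: powr_mult)
  also have "\<dots> \<le> 2 powr p * (a powr p + b powr p)"
    by (intro mult_left_mono) (auto simp: max_def)
  finally show ?thesis .
qed

text \<open>Truncate F at height k, with an error controlled by dominated convergence against |F|^p,
  then approximate the bounded truncation.\<close>

lemma Lp_approx:
  fixes F :: "real \<Rightarrow> real"
  assumes F: "F \<in> borel_measurable torus" "integrable torus (\<lambda>x. \<bar>F x\<bar> powr p)" and p: "p > 0" and d: "d > 0"
  obtains G where "continuous_on UNIV G" "period 1 G"
    "integrable torus (\<lambda>x. \<bar>F x - G x\<bar> powr p)" "(\<integral>x. \<bar>F x - G x\<bar> powr p \<partial>torus) < d"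
proof -
  \<comment> \<open>There are two errors of size d', and \<open>powr_add_le\<close> costs a factor
    2^p when they are combined.\<close>
  define d' where "d' = d / (2 * 2 powr p)"
  have d': "d' > 0" using d by (simp add: d'_def)
  define T where "T = (\<lambda>k x. max (- real k) (min (real k) (F x)))"
  have T_meas [measurable]: "T k \<in> borel_measurable torus" for k
    unfolding T_def using F(1) by measurable
  have T_le: "\<bar>F x - T k x\<bar> \<le> \<bar>F x\<bar>" for k x by (auto simp: T_def)
  have T_bound: "\<bar>F x - T k x\<bar> powr p \<le> \<bar>F x\<bar> powr p" for k x
    using T_le p by (intro powr_mono2) auto
  have T_int: "integrable torus (\<lambda>x. \<bar>F x - T k x\<bar> powr p)" for k
    by (rule Bochner_Integration.integrable_bound[OF F(2)]) (use F(1) T_bound in auto)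
  have "(\<lambda>k. \<integral>x. \<bar>F x - T k x\<bar> powr p \<partial>torus) \<longlonglongrightarrow> (\<integral>x. 0 \<partial>torus)"
  proof (rule integral_dominated_convergence[OF _ _ F(2)])
    show "(\<lambda>x. \<bar>F x - T k x\<bar> powr p) \<in> borel_measurable torus" for k using F(1) by simp
    show "AE x in torus. (\<lambda>k. \<bar>F x - T k x\<bar> powr p) \<longlonglongrightarrow> 0"
    proof (intro AE_I2 tendsto_eventually)
      fix x
      show "\<forall>\<^sub>F k in sequentially. \<bar>F x - T k x\<bar> powr p = 0"
        using eventually_ge_at_top[of "nat \<lceil>\<bar>F x\<bar>\<rceil>"]
      proof eventually_elim
        case (elim k)
        then have "\<bar>F x\<bar> \<le> real k" by linarith
        then show ?case by (simp add: T_def)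
      qed
    qed
  qed (use T_bound in auto)
  then have "\<forall>\<^sub>F k in sequentially. (\<integral>x. \<bar>F x - T k x\<bar> powr p \<partial>torus) < d'"
    using d' by (intro order_tendstoD(2)) auto
  then obtain k where k: "(\<integral>x. \<bar>F x - T k x\<bar> powr p \<partial>torus) < d'"
    by (auto simp: eventually_sequentially)
  obtain G where G: "continuous_on UNIV G" "period 1 G" "\<And>x. \<bar>G x\<bar> \<le> real k"
    "(\<integral>x. \<bar>T k x - G x\<bar> powr p \<partial>torus) < d'"
    by (rule bounded_approx[OF T_meas[of k] _ p d', of "real k"]) (auto simp: T_def)
  have [measurable]: "G \<in> borel_measurable torus" by (rule borel_measurable_torus[OF G(1)])
  have TG_int: "integrable torus (\<lambda>x. \<bar>T k x - G x\<bar> powr p)"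
  proof (rule finite_measure.integrable_const_bound[OF finite_measure_torus, of _ "(2 * real k) powr p"])
    have "\<bar>T k x - G x\<bar> \<le> 2 * real k" for x using G(3)[of x] by (auto simp: T_def)
    then show "AE x in torus. norm (\<bar>T k x - G x\<bar> powr p) \<le> (2 * real k) powr p"
      using p by (intro AE_I2) (simp add: powr_mono2)
  qed simp
  have le: "\<bar>F x - G x\<bar> powr p \<le> 2 powr p * (\<bar>F x - T k x\<bar> powr p + \<bar>T k x - G x\<bar> powr p)" for x
  proof -
    have "\<bar>F x - G x\<bar> powr p \<le> (\<bar>F x - T k x\<bar> + \<bar>T k x - G x\<bar>) powr p"
      using p by (intro powr_mono2) auto
    then show ?thesis using powr_add_le[OF _ _ p, of "\<bar>F x - T k x\<bar>" "\<bar>T k x - G x\<bar>"] by simp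
  qed
  have int: "integrable torus (\<lambda>x. 2 powr p * (\<bar>F x - T k x\<bar> powr p + \<bar>T k x - G x\<bar> powr p))"
    using T_int TG_int by simp
  have FG: "integrable torus (\<lambda>x. \<bar>F x - G x\<bar> powr p)"
    by (rule Bochner_Integration.integrable_bound[OF int]) (use F(1) le in \<open>auto intro!: AE_I2\<close>)
  have "(\<integral>x. \<bar>F x - G x\<bar> powr p \<partial>torus)
      \<le> (\<integral>x. 2 powr p * (\<bar>F x - T k x\<bar> powr p + \<bar>T k x - G x\<bar> powr p) \<partial>torus)"
    by (intro integral_mono FG int le)
  also have "\<dots> = 2 powr p * ((\<integral>x. \<bar>F x - T k x\<bar> powr p \<partial>torus) + (\<integral>x. \<bar>T k x - G x\<bar> powr p \<partial>torus))"
    using T_int TG_int by simp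
  also have "\<dots> < 2 powr p * (d' + d')" using k G(4) by (intro mult_strict_left_mono add_strict_mono) auto
  also have "\<dots> = d" by (simp add: d'_def)
  finally show ?thesis using that G FG by blast
qed

section \<open>From the maximal inequality to almost everywhere convergence\<close>

text \<open>Banach's principle: choose a continuous G close to F in L^p. The averages of G are
  uniformly Cauchy, and by the maximal inequality those of |F - G| exceed e/3 only on a set of small
  measure.\<close>

lemma AE_Cauchy_avg:
  fixes q c :: nat and F :: "real \<Rightarrow> real"
  defines "p \<equiv> real q / (real q - 1)"
  assumes q: "q \<ge> 2" and I: "countable I" "\<And>i. i \<in> I \<Longrightarrow> finite (snd i) \<and> card (snd i) \<le> c"
    and F: "torus_integrable F" "integrable torus (\<lambda>x. \<bar>F x\<bar> powr p)"
  shows "AE x in torus. \<forall>e>0. \<exists>N. \<forall>n\<in>primorial_except ` I. \<forall>m\<in>primorial_except ` I.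
    N \<le> n \<longrightarrow> N \<le> m \<longrightarrow> \<bar>avg n F x - avg m F x\<bar> \<le> e"
proof -
  define close where "close = (\<lambda>x e. \<exists>N. \<forall>n\<in>primorial_except ` I. \<forall>m\<in>primorial_except ` I.
    N \<le> n \<longrightarrow> N \<le> m \<longrightarrow> \<bar>avg n F x - avg m F x\<bar> \<le> e)"
  have p: "p > 0" using q by (simp add: p_def)
  have F_meas: "F \<in> borel_measurable torus" using F(1) by (auto simp: torus_integrable_def)
  have AE_close: "AE x in torus. close x e" if e: "e > 0" for e
  proof (rule AE_torus_if_small_exceptions)
    fix d :: real assume d: "d > 0"
    obtain K where K: "K \<ge> 0" "\<And>I F. countable I \<Longrightarrow> (\<And>i. i \<in> I \<Longrightarrow> finite (snd i) \<and> card (snd i) \<le> c) \<Longrightarrow>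
      torus_integrable F \<Longrightarrow> (\<And>x. F x \<ge> 0) \<Longrightarrow> integrable torus (\<lambda>x. F x powr p) \<Longrightarrow>
      \<exists>A\<in>sets torus. measure torus A \<le> K * (\<integral>x. F x powr p \<partial>torus) \<and>
        (\<forall>x\<in>{0..<1} - A. \<forall>i\<in>I. avg (primorial_except i) F x \<le> e / 3)"
      unfolding p_def by (rule maximal_inequality[OF q, of "e / 3" c]) (use e in simp, blast)
    \<comment> \<open>Adding 1 covers K = 0 and still keeps K times this quantity at most d.\<close>
    have "d / (K + 1) > 0" using K(1) d by simp
    then obtain G where G: "continuous_on UNIV G" "period 1 G"
      "integrable torus (\<lambda>x. \<bar>F x - G x\<bar> powr p)" "(\<integral>x. \<bar>F x - G x\<bar> powr p \<partial>torus) < d / (K + 1)"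
      using Lp_approx[OF F_meas F(2) p] by blast
    have "bounded (G ` {0..1})"
      by (intro compact_imp_bounded compact_continuous_image continuous_on_subset[OF G(1)]) auto
    then obtain B where B: "\<And>x. x \<in> {0..1} \<Longrightarrow> \<bar>G x\<bar> \<le> B"
      unfolding bounded_iff real_norm_def by blast
    have "\<bar>G x\<bar> \<le> B" for x
      using B[of "frac x"] period_int_multiple[OF G(2), of "frac x" "\<lfloor>x\<rfloor>"] frac_lt_1[of x]
      by (simp add: frac_def)
    then have "torus_bounded G" by (intro torus_boundedI[of _ B] G borel_measurable_torus)
    then have FG: "torus_integrable (\<lambda>x. \<bar>F x - G x\<bar>)"
      using F(1) by (auto simp: torus_bounded_def torus_integrable_def period_def)
    obtain A where A: "A \<in> sets torus" "measure torus A \<le> K * (\<integral>x. \<bar>F x - G x\<bar> powr p \<partial>torus)"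
      "\<And>x i. x \<in> {0..<1} - A \<Longrightarrow> i \<in> I \<Longrightarrow> avg (primorial_except i) (\<lambda>x. \<bar>F x - G x\<bar>) x \<le> e / 3"
      using K(2)[OF I FG _ G(3)] by auto
    have "K * (\<integral>x. \<bar>F x - G x\<bar> powr p \<partial>torus) \<le> K * (d / (K + 1))"
      using G(4) K(1) by (intro mult_left_mono) auto
    also have "\<dots> \<le> d" using K(1) d by (simp add: field_simps)
    finally have "measure torus A \<le> d" using A(2) by simp
    moreover have "close x e" if x: "x \<in> {0..<1} - A" for x
    proof -
      obtain N where N: "\<And>n m. n \<ge> N \<Longrightarrow> m \<ge> N \<Longrightarrow> \<bar>avg n G x - avg m G x\<bar> \<le> e / 3"
        using uniform_Cauchy_avg[OF G(1,2), of "e / 3"] e by auto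
      have near: "\<bar>avg n F x - avg n G x\<bar> \<le> e / 3" if "n \<in> primorial_except ` I" for n
        using that A(3)[OF x] avg_abs_diff_le[of n F x G] by fastforce
      have "\<bar>avg n F x - avg m F x\<bar> \<le> e"
        if "n \<in> primorial_except ` I" "m \<in> primorial_except ` I" "N \<le> n" "N \<le> m" for n m
        using near[OF that(1)] near[OF that(2)] N[OF that(3,4)] by linarith
      then show ?thesis unfolding close_def by blast
    qed
    ultimately show "\<exists>A\<in>sets torus. measure torus A \<le> d \<and> (\<forall>x\<in>{0..<1} - A. close x e)"
      using A(1) by blast
  qed
  \<comment> \<open>Countably many tolerances suffice, so one null set serves for all e.\<close>
  have "AE x in torus. \<forall>k. close x (1 / real (Suc k))"
    unfolding AE_all_countable by (intro allI AE_close) simp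
  then have "AE x in torus. \<forall>e>0. close x e"
  proof eventually_elim
    case (elim x)
    show ?case
    proof (intro allI impI)
      fix e :: real assume "e > 0"
      then obtain k where "inverse (real (Suc k)) < e" using reals_Archimedean by blast
      then have "1 / real (Suc k) \<le> e" by (simp add: inverse_eq_divide)
      then show "close x e" using elim unfolding close_def by (meson order_trans)
    qed
  qed
  then show ?thesis unfolding close_def .
qed

text \<open>Evaluating u at the next element of E turns it into an ordinary Cauchy sequence that
  agrees with u on E; completeness then supplies the limit.\<close>

lemma convergent_along_if_Cauchy:
  fixes u :: "nat \<Rightarrow> real"
  assumes E: "infinite E"
    and u: "\<forall>e>0. \<exists>N. \<forall>n\<in>E. \<forall>m\<in>E. N \<le> n \<longrightarrow> N \<le> m \<longrightarrow> \<bar>u n - u m\<bar> \<le> e"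
  obtains L where "(u \<longlongrightarrow> L) (inf sequentially (principal E))"
proof -
  define nxt where "nxt = (\<lambda>k. LEAST n. n \<in> E \<and> k \<le> n)"
  have nxt: "nxt k \<in> E" "k \<le> nxt k" for k
  proof -
    have "\<exists>n. n \<in> E \<and> k \<le> n" using E unfolding infinite_nat_iff_unbounded_le by blast
    then have "nxt k \<in> E \<and> k \<le> nxt k" unfolding nxt_def by (rule LeastI_ex)
    then show "nxt k \<in> E" "k \<le> nxt k" by auto
  qed
  have nxt_id: "nxt n = n" if "n \<in> E" for n
    unfolding nxt_def using that by (intro Least_equality) auto
  have "Cauchy (\<lambda>k. u (nxt k))"
  proof (rule CauchyI)
    fix e :: real assume e: "e > 0"
    then obtain N where N: "\<And>n m. n \<in> E \<Longrightarrow> m \<in> E \<Longrightarrow> N \<le> n \<Longrightarrow> N \<le> m \<Longrightarrow> \<bar>u n - u m\<bar> \<le> e / 2"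
      using u[rule_format, of "e / 2"] by auto
    have "norm (u (nxt m) - u (nxt n)) < e" if "m \<ge> N" "n \<ge> N" for m n
      using N[of "nxt m" "nxt n"] nxt(1) order_trans[OF that(1) nxt(2)] order_trans[OF that(2) nxt(2)] e
      by fastforce
    then show "\<exists>N. \<forall>m\<ge>N. \<forall>n\<ge>N. norm (u (nxt m) - u (nxt n)) < e" by blast
  qed
  then obtain L where "(\<lambda>k. u (nxt k)) \<longlonglongrightarrow> L" by (auto simp: Cauchy_convergent_iff convergent_def)
  then have "((\<lambda>k. u (nxt k)) \<longlongrightarrow> L) (inf sequentially (principal E))"
    by (rule tendsto_mono[OF inf_le1])
  moreover have "\<forall>\<^sub>F k in inf sequentially (principal E). u (nxt k) = u k"
    by (auto simp: eventually_inf_principal nxt_id)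
  ultimately have "(u \<longlongrightarrow> L) (inf sequentially (principal E))"
    by (rule Lim_transform_eventually)
  then show ?thesis by (rule that)
qed

lemma AE_convergent_avg:
  fixes F :: "real \<Rightarrow> real"
  assumes p: "p > 1" and F: "period 1 F" "F \<in> borel_measurable torus" "integrable torus (\<lambda>x. \<bar>F x\<bar> powr p)"
  shows "AE x in torus. \<exists>L. ((\<lambda>n. avg n F x) \<longlongrightarrow> L) (inf sequentially (principal near_primorials))"
proof -
  define I :: "(nat \<times> nat set) set" where "I = range (\<lambda>(y, a, b). (y, {a, b}))"
  have I: "countable I" "\<And>i. i \<in> I \<Longrightarrow> finite (snd i) \<and> card (snd i) \<le> 2"
    unfolding I_def by (auto simp: card_insert_if)
  have E: "primorial_except ` I = near_primorials"
    unfolding I_def near_primorials_def image_image by (intro arg_cong2[of _ _ _ _ "(`)"]) auto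
  \<comment> \<open>The moment expansion needs an integer exponent. Rounding the conjugate exponent
    of p up makes p' = q/(q-1) at most p, so F also lies in L^p' because the torus has finite
    measure.\<close>
  define q where "q = nat \<lceil>p / (p - 1)\<rceil>"
  have "p / (p - 1) > 1" using p by simp
  then have q: "q \<ge> 2" "real q \<ge> p / (p - 1)" unfolding q_def by linarith+
  define p' where "p' = real q / (real q - 1)"
  have p': "1 \<le> p'" "p' \<le> p" using p q unfolding p'_def by (auto simp: field_simps)
  \<comment> \<open>The pointwise form of the inclusion of L^p in L^r, used below for r = p' and for
    r = 1.\<close>
  have small: "\<bar>F x\<bar> powr r \<le> 1 + \<bar>F x\<bar> powr p" if "1 \<le> r" "r \<le> p" for x r
  proof (cases "\<bar>F x\<bar> \<le> 1")
    case True
    then have "\<bar>F x\<bar> powr r \<le> 1 powr r" using that by (intro powr_mono2) auto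
    then show ?thesis by (simp add: add_increasing2)
  next
    case False
    then have "\<bar>F x\<bar> powr r \<le> \<bar>F x\<bar> powr p" using that by (intro powr_mono) auto
    then show ?thesis by simp
  qed
  have int: "integrable torus (\<lambda>x. 1 + \<bar>F x\<bar> powr p)"
    by (intro Bochner_Integration.integrable_add F(3) finite_measure.integrable_const finite_measure_torus)
  have "integrable torus (\<lambda>x. \<bar>F x\<bar> powr p')"
    by (rule Bochner_Integration.integrable_bound[OF int]) (use F(2) small[OF p'] in \<open>auto intro!: AE_I2\<close>)
  moreover have "integrable torus F"
    by (rule Bochner_Integration.integrable_bound[OF int]) (use F(2) small[of 1] p in \<open>auto intro!: AE_I2\<close>)
  ultimately have "AE x in torus. \<forall>e>0. \<exists>N. \<forall>n\<in>primorial_except ` I. \<forall>m\<in>primorial_except ` I.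
    N \<le> n \<longrightarrow> N \<le> m \<longrightarrow> \<bar>avg n F x - avg m F x\<bar> \<le> e"
    unfolding p'_def using F(1) by (intro AE_Cauchy_avg[OF q(1) I]) (auto simp: torus_integrable_def)
  then show ?thesis unfolding E
  proof eventually_elim
    case (elim x)
    from convergent_along_if_Cauchy[OF infinite_near_primorials elim] show ?case by blast
  qed
qed

theorem mainTheorem3:
  shows "\<exists>E :: nat set. E \<subseteq> {0<..} \<and> infinite_dimension E \<and>
    (\<forall>(p :: real) (f :: real \<Rightarrow> complex). 1 < p \<longrightarrow> in_Lp p f \<longrightarrow>
      (AE x in torus. converges_along E (\<lambda>n. riemann_sum n f x)))"
proof (intro exI conjI allI impI)
  show "near_primorials \<subseteq> {0<..}" by (auto simp: near_primorials_def primorial_except_pos)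
  show "infinite_dimension near_primorials"
    using not_covered_near_primorials by (auto simp: infinite_dimension_def has_dimension_def)
  fix p :: real and f :: "real \<Rightarrow> complex"
  assume p: "1 < p" and "in_Lp p f"
  then have f: "f \<in> borel_measurable torus" "integrable torus (\<lambda>x. norm (f x) powr p)"
    by (auto simp: in_Lp_def)
  \<comment> \<open>P stands for \<open>Re\<close> or \<open>Im\<close>: domination by the norm
    transfers integrability of the p-th power from f to either part.\<close>
  have conv: "AE x in torus. \<exists>L. ((\<lambda>n. avg n (\<lambda>y. P (f (frac y))) x) \<longlongrightarrow> L) (inf sequentially (principal near_primorials))"
    if P: "P \<in> borel_measurable borel" "\<And>z. \<bar>P z\<bar> \<le> norm z" for P :: "complex \<Rightarrow> real"
  proof (rule AE_convergent_avg[OF p])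
    have frac: "frac x = x" if "x \<in> space torus" for x using that by (simp add: frac_eq)
    have meas: "(\<lambda>x. P (f x)) \<in> borel_measurable torus" using P(1) f(1) by measurable
    then show "(\<lambda>y. P (f (frac y))) \<in> borel_measurable torus"
      by (rule subst[OF measurable_cong, rotated]) (simp add: frac)
    have "integrable torus (\<lambda>x. \<bar>P (f x)\<bar> powr p)"
      by (rule Bochner_Integration.integrable_bound[OF f(2)])
        (use meas P(2) p in \<open>auto intro!: AE_I2 powr_mono2\<close>)
    then show "integrable torus (\<lambda>x. \<bar>P (f (frac x))\<bar> powr p)"
      by (rule subst[OF Bochner_Integration.integrable_cong[OF refl], rotated]) (simp add: frac)
    show "period 1 (\<lambda>y. P (f (frac y)))" by (simp add: period_def frac_1_eq)
  qed
  have "AE x in torus. \<exists>L. ((\<lambda>n. avg n (\<lambda>y. Re (f (frac y))) x) \<longlongrightarrow> L) (inf sequentially (principal near_primorials))"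
    by (rule conv) (auto simp: abs_Re_le_cmod)
  moreover have "AE x in torus. \<exists>L. ((\<lambda>n. avg n (\<lambda>y. Im (f (frac y))) x) \<longlongrightarrow> L) (inf sequentially (principal near_primorials))"
    by (rule conv) (auto simp: abs_Im_le_cmod)
  ultimately show "AE x in torus. converges_along near_primorials (\<lambda>n. riemann_sum n f x)"
  proof eventually_elim
    case (elim x)
    then obtain L L' where
      "((\<lambda>n. avg n (\<lambda>y. Re (f (frac y))) x) \<longlongrightarrow> L) (inf sequentially (principal near_primorials))"
      "((\<lambda>n. avg n (\<lambda>y. Im (f (frac y))) x) \<longlongrightarrow> L') (inf sequentially (principal near_primorials))"
      by blast
    then have "((\<lambda>n. Complex (avg n (\<lambda>y. Re (f (frac y))) x) (avg n (\<lambda>y. Im (f (frac y))) x))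
      \<longlongrightarrow> Complex L L') (inf sequentially (principal near_primorials))"
      by (rule tendsto_Complex)
    moreover have "riemann_sum n f x = Complex (avg n (\<lambda>y. Re (f (frac y))) x) (avg n (\<lambda>y. Im (f (frac y))) x)" for n
      by (simp add: riemann_sum_def avg_def complex_eq_iff)
    ultimately show ?case by (auto simp: converges_along_def)
  qed
qed

end
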